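(* Let $\{|a\rangle : a=1,\dots,d_{\rm H}\}$ be an orthonormal basis of a $d_{\rm H}$-dimensional Hilbert space, and define the unit vectors $$|\psi^{\rm x}_{a,b}\rangle=\tfrac{1}{\sqrt2}(|a\rangle+|b\rangle),\quad |\psi^{\rm y}_{a,b}\rangle=\tfrac{1}{\sqrt2}(|a\rangle+i|b\rangle),$$ $$|\psi^{\rm x}_{a,b,c}\rangle=\tfrac{1}{\sqrt3}(|a\rangle+|b\rangle+|c\rangle),\quad |\psi^{\rm y}_{a,b,c}\rangle=\tfrac{1}{\sqrt3}(|a\rangle+i|b\rangle+i|c\rangle),$$ and the rank-one projections $\pi_a=|a\rangle\langle a|$, $\pi^{\rm x}_{a,b}=|\psi^{\rm x}_{a,b}\rangle\langle\psi^{\rm x}_{a,b}|$, $\pi^{\rm y}_{a,b}=|\psi^{\rm y}_{a,b}\rangle\langle\psi^{\rm y}_{a,b}|$, $\pi^{\rm x}_{a,b,c}=|\psi^{\rm x}_{a,b,c}\rangle\langle\psi^{\rm x}_{a,b,c}|$, $\pi^{\rm y}_{a,b,c}=|\psi^{\rm y}_{a,b,c}\rangle\langle\psi^{\rm y}_{a,b,c}|$. Let $$\Pi=\{\pi_a,\ \pi^{\rm x}_{a,b},\ \pi^{\rm y}_{a,b},\ \pi^{\rm x}_{a,b,c},\ \pi^{\rm y}_{a,b,c},\ \pi^{\rm y}_{c,b,a} : a<b<c\},$$ meaning all $\pi_a$, all $\pi^{\rm x}_{a,b},\pi^{\rm y}_{a,b}$ with $a<b$, and all $\pi^{\rm x}_{a,b,c},\pi^{\rm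 y}_{a,b,c},\pi^{\rm y}_{c,b,a}$ with $a<b<c$ (the three-index projections being absent when $d_{\rm H}=2$). Let $\mathfrak{m}=\{\{\rho_i\},\{\mathcal{M}_j\},\{E_k\}\}$ be a physical representation. If $\{\rho_i\}\supset\Pi$ and $\{E_k\}\supset\Pi$, then the physical model $[\mathfrak{m}]$ is unique.
   Context: Fix a Hilbert space of finite dimension $d_{\rm H}$, identified with $\mathbb{C}^{d_{\rm H}}$ through an orthonormal basis $\{|a\rangle\}$; $\mathbb{1}$ is the identity matrix. A representation $\mathfrak{m}=\{\{\rho_i\},\{\mathcal{M}_j\},\{E_k\}\}$ consists of an indexed family of $d_{\rm H}\times d_{\rm H}$ complex matrices $\rho_i$ (states), an indexed family of linear maps $\mathcal{M}_j$ on the space of $d_{\rm H}\times d_{\rm H}$ complex matrices, and an indexed family of $d_{\rm H}\times d_{\rm H}$ matrices $E_k$ (measurement operators). It is physical if every $\rho_i$ is Hermitian, positive semidefinite with $\mathrm{Tr}(\rho_i)=1$, every $\mathcal{M}_j$ is completely positive and trace-preserving, and every $E_k$ is Hermitian with $0\le E_k\le \mathbb{1}$. Its probability distribution is $p_{\mathfrak{m}}(i,j_1,\dots,j_N,k)=\mathrm{Tr}[E_k\,\mathcal{M}_{j_N}\cdots\mathcal{M}_{j_1}(\rho_i)]$ for all $i,k$, all $N\ge 0$ and all $j_1,\dots,j_N$ ($N=0$ meaning no map is applied). Let $\langle\mathfrak{m}\rangle$ be the set of all physical representations $\mathfrak{m}'$ (same index sets, same dimension $d_{\rm H}$) with $p_{\mathfrak{m}'}=p_{\mathfrak{m}}$.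 For an invertible linear map $\mathcal{T}$ on the matrix space, put $\mathcal{T}(\mathfrak{m})=\{\{\mathcal{T}^{-1}(\rho_i)\},\{\mathcal{T}^{-1}\mathcal{M}_j\mathcal{T}\},\{\mathcal{T}^*(E_k)\}\}$, where $\mathcal{T}^*$ is the dual map defined by $\mathrm{Tr}[\mathcal{T}^*(A)B]=\mathrm{Tr}[A\,\mathcal{T}(B)]$ for all matrices $A,B$. Let $\mathbb{U}$ be the set of unitary maps $\mathcal{U}(X)=uXu^\dagger$ with $u$ a unitary $d_{\rm H}\times d_{\rm H}$ matrix, let $\mathcal{W}(X)=X^{\rm T}$ be the transpose map in the fixed basis, and let $\mathbb{S}=\mathbb{U}\cup\mathcal{W}\mathbb{U}$, where $\mathcal{W}\mathbb{U}=\{\mathcal{W}\circ\mathcal{U}:\mathcal{U}\in\mathbb{U}\}$ (unitary and anti-unitary transformations). The model of $\mathfrak{m}$ is $[\mathfrak{m}]=\{\mathcal{S}(\mathfrak{m}) : \mathcal{S}\in\mathbb{S}\}$; it is called physical if $\mathfrak{m}$ is physical, and a physical model is unique if $[\mathfrak{m}]=\langle\mathfrak{m}\rangle$. *)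

theory Defs
  imports "HOL-Analysis.Analysis"
begin

(* The Hilbert space is complex ^ 'n with standard orthonormal basis |a> = axis a 1, a :: 'n,
   and d_H = CARD('n). *)

type_synonym 'n cmat = "complex ^ 'n ^ 'n"


section \<open>Matrices\<close>

definition cinner :: "complex ^ 'n \<Rightarrow> complex ^ 'n \<Rightarrow> complex" where
  "cinner x y = (\<Sum>a\<in>UNIV. cnj (x $ a) * y $ a)"

definition mat_adjoint :: "('n::finite) cmat \<Rightarrow> 'n cmat" where
  "mat_adjoint A = (\<chi> a b. cnj (A $ b $ a))"

definition hermitian :: "('n::finite) cmat \<Rightarrow> bool" where
  "hermitian A \<longleftrightarrow> mat_adjoint A = A"

(* For Hermitian A the number cinner v (A *v v) is real. *)
definition pos_semidef :: "('n::finite) cmat \<Rightarrow> bool" where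
  "pos_semidef A \<longleftrightarrow> hermitian A \<and> (\<forall>v. 0 \<le> Re (cinner v (A *v v)))"

definition unitary_mat :: "('n::finite) cmat \<Rightarrow> bool" where
  "unitary_mat u \<longleftrightarrow> mat_adjoint u ** u = mat 1 \<and> u ** mat_adjoint u = mat 1"

definition rank_one_proj :: "complex ^ ('n::finite) \<Rightarrow> 'n cmat" where
  "rank_one_proj v = (\<chi> a b. v $ a * cnj (v $ b))"


section \<open>Linear maps on matrices\<close>

(* Neither *s nor *R is complex scalar multiplication on complex ^ 'n ^ 'n. *)
definition mat_scale :: "complex \<Rightarrow> ('n::finite) cmat \<Rightarrow> 'n cmat" where
  "mat_scale c A = (\<chi> a b. c * A $ a $ b)"

lemma vector_space_mat_scale: "vector_space mat_scale"
  by standard (simp_all add: mat_scale_def vec_eq_iff algebra_simps)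

abbreviation mat_linear :: "(('n::finite) cmat \<Rightarrow> 'n cmat) \<Rightarrow> bool" where
  "mat_linear \<equiv> Vector_Spaces.linear mat_scale mat_scale"

lemma mat_linear_iff:
  "mat_linear T \<longleftrightarrow>
     (\<forall>A B. T (A + B) = T A + T B) \<and> (\<forall>c A. T (mat_scale c A) = mat_scale c (T A))"
  using vector_space_mat_scale
  by (auto simp: Vector_Spaces.linear_def module_hom_def module_hom_axioms_def
      module_iff_vector_space)

(* A k-by-k block matrix (X p q), p, q < k, with d_H-by-d_H blocks represents the operator
   sum over p, q of X p q \<otimes> |p><q| on C^d_H \<otimes> C^k. *)
definition block_pos_semidef :: "nat \<Rightarrow> (nat \<Rightarrow> nat \<Rightarrow> ('n::finite) cmat) \<Rightarrow> bool" where
  "block_pos_semidef k X \<longleftrightarrow>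
     (\<forall>p<k. \<forall>q<k. mat_adjoint (X p q) = X q p) \<and>
     (\<forall>v :: nat \<Rightarrow> complex ^ 'n. 0 \<le> Re (\<Sum>p<k. \<Sum>q<k. cinner (v p) (X p q *v v q)))"

(* Every ampliation M \<otimes> id_k, which acts blockwise, is a positive map. *)
definition completely_positive :: "(('n::finite) cmat \<Rightarrow> 'n cmat) \<Rightarrow> bool" where
  "completely_positive M \<longleftrightarrow> mat_linear M \<and>
     (\<forall>k X. block_pos_semidef k X \<longrightarrow> block_pos_semidef k (\<lambda>p q. M (X p q)))"

definition trace_preserving :: "(('n::finite) cmat \<Rightarrow> 'n cmat) \<Rightarrow> bool" where
  "trace_preserving M \<longleftrightarrow> (\<forall>A. trace (M A) = trace A)"

definition dual_map :: "(('n::finite) cmat \<Rightarrow> 'n cmat) \<Rightarrow> 'n cmat \<Rightarrow> 'n cmat" where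
  "dual_map T = (THE T'. \<forall>A B. trace (T' A ** B) = trace (A ** T B))"

definition mat_unit :: "'n::finite \<Rightarrow> 'n \<Rightarrow> 'n cmat" where
  "mat_unit a b = (\<chi> i j. if i = a \<and> j = b then 1 else 0)"

lemma trace_mult_mat_unit: "trace (A ** mat_unit a b) = A $ b $ a"
  by (simp add: trace_def matrix_matrix_mult_def mat_unit_def if_distrib [of "\<lambda>x. _ * x"]
      sum.If_cases flip: if_if_eq_conj cong: if_cong)

lemma dual_map_eqI:
  assumes "\<And>A B. trace (T' A ** B) = trace (A ** T B)"
  shows "dual_map T = T'"
  unfolding dual_map_def
proof (rule the_equality)
  fix S assume S: "\<forall>A B. trace (S A ** B) = trace (A ** T B)"
  have "S A $ b $ a = T' A $ b $ a" for A a b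
    using S assms by (metis trace_mult_mat_unit)
  then show "S = T'"
    by (simp add: fun_eq_iff vec_eq_iff)
qed (simp add: assms)

lemma trace_dual_map:
  assumes "mat_linear T"
  shows "trace (dual_map T A ** B) = trace (A ** T B)"
proof -
  interpret Vector_Spaces.linear mat_scale mat_scale T by fact
  define S where "S A = (\<chi> i j. trace (A ** T (mat_unit j i)))" for A
  have "trace (S A ** B) = trace (A ** T B)" for A B
  proof -
    have B: "B = (\<Sum>j\<in>UNIV. \<Sum>i\<in>UNIV. mat_scale (B $ j $ i) (mat_unit j i))"
    proof -
      have "(\<Sum>j\<in>UNIV. \<Sum>i\<in>UNIV. mat_scale (B $ j $ i) (mat_unit j i)) $ a $ b =
          (\<Sum>j\<in>UNIV. if a = j then \<Sum>i\<in>UNIV. if b = i then B $ j $ i else 0 else 0)" for a b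
        unfolding sum_component
        by (rule sum.cong [OF refl])
          (simp add: mat_scale_def mat_unit_def if_distrib [of "\<lambda>x. _ * x"] cong: if_cong)
      then show ?thesis
        by (simp add: vec_eq_iff)
    qed
    have lin: "trace (A ** sum f I) = (\<Sum>i\<in>I. trace (A ** f i))" for f :: "'a \<Rightarrow> 'a cmat" and I
      by (induction I rule: infinite_finite_induct)
        (simp_all add: trace_add matrix_add_ldistrib, simp_all add: trace_def matrix_matrix_mult_def)
    have sc: "trace (A ** mat_scale c C) = c * trace (A ** C)" for c C
      by (simp add: trace_def matrix_matrix_mult_def mat_scale_def sum_distrib_left mult.left_commute)
    have "trace (A ** T B) = (\<Sum>j\<in>UNIV. \<Sum>i\<in>UNIV. B $ j $ i * S A $ i $ j)"
      by (subst B) (simp add: sum scale lin sc S_def)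
    also have "\<dots> = trace (S A ** B)"
      by (subst sum.swap) (simp add: trace_def matrix_matrix_mult_def mult.commute)
    finally show ?thesis by simp
  qed
  then show ?thesis
    using dual_map_eqI [of S T] by simp
qed


section \<open>Representations\<close>

(* Indexed families are partial functions; their domains are the index sets, which are
   arbitrary and may be empty. *)
record ('i, 'j, 'k, 'n) representation =
  states :: "'i \<Rightarrow> ('n cmat) option"
  maps :: "'j \<Rightarrow> ('n cmat \<Rightarrow> 'n cmat) option"
  measurements :: "'k \<Rightarrow> ('n cmat) option"

definition physical :: "('i, 'j, 'k, 'n::finite) representation \<Rightarrow> bool" where
  "physical m \<longleftrightarrow>
     (\<forall>\<rho>\<in>ran (states m). pos_semidef \<rho> \<and> trace \<rho> = 1) \<and>
     (\<forall>M\<in>ran (maps m). completely_positive M \<and> trace_preserving M) \<and>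
     (\<forall>E\<in>ran (measurements m). pos_semidef E \<and> pos_semidef (mat 1 - E))"

(* Tr[E_k M_jN ... M_j1 (rho_i)] for js = [j1, ..., jN] *)
definition prob_dist :: "('i, 'j, 'k, 'n::finite) representation \<Rightarrow> 'i \<Rightarrow> 'j list \<Rightarrow> 'k \<Rightarrow> complex" where
  "prob_dist m i js k =
     trace (the (measurements m k) ** fold (\<lambda>j. the (maps m j)) js (the (states m i)))"

definition same_prob_dist ::
  "('i, 'j, 'k, 'n::finite) representation \<Rightarrow> ('i, 'j, 'k, 'n) representation \<Rightarrow> bool" where
  "same_prob_dist m' m \<longleftrightarrow>
     dom (states m') = dom (states m) \<and>
     dom (maps m') = dom (maps m) \<and>
     dom (measurements m') = dom (measurements m) \<and>
     (\<forall>i\<in>dom (states m). \<forall>js\<in>lists (dom (maps m)). \<forall>k\<in>dom (measurements m).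
        prob_dist m' i js k = prob_dist m i js k)"

definition equivalent_physical ::
  "('i, 'j, 'k, 'n::finite) representation \<Rightarrow> ('i, 'j, 'k, 'n) representation set" where
  "equivalent_physical m = {m'. physical m' \<and> same_prob_dist m' m}"

definition transform ::
  "('n cmat \<Rightarrow> 'n cmat) \<Rightarrow> ('i, 'j, 'k, 'n::finite) representation \<Rightarrow> ('i, 'j, 'k, 'n) representation" where
  "transform T m =
     \<lparr>states = (\<lambda>i. map_option (inv T) (states m i)),
      maps = (\<lambda>j. map_option (\<lambda>M. inv T \<circ> M \<circ> T) (maps m j)),
      measurements = (\<lambda>k. map_option (dual_map T) (measurements m k))\<rparr>"


section \<open>Models\<close>

definition unitary_maps :: "(('n::finite) cmat \<Rightarrow> 'n cmat) set" where
  "unitary_maps = {\<lambda>X. u ** X ** mat_adjoint u | u. unitary_mat u}"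

definition symmetry_maps :: "(('n::finite) cmat \<Rightarrow> 'n cmat) set" where
  "symmetry_maps = unitary_maps \<union> {transpose \<circ> U | U. U \<in> unitary_maps}"

definition model_of ::
  "('i, 'j, 'k, 'n::finite) representation \<Rightarrow> ('i, 'j, 'k, 'n) representation set" where
  "model_of m = {transform S m | S. S \<in> symmetry_maps}"

(* Uniqueness is a property of physical models. *)
definition unique_model :: "('i, 'j, 'k, 'n::finite) representation \<Rightarrow> bool" where
  "unique_model m \<longleftrightarrow> physical m \<and> model_of m = equivalent_physical m"


section \<open>The family of projections\<close>

abbreviation ket :: "'n::finite \<Rightarrow> complex ^ 'n" where
  "ket a \<equiv> axis a 1"

definition psi_x2 :: "'n::finite \<Rightarrow> 'n \<Rightarrow> complex ^ 'n" where
  "psi_x2 a b = (1 / sqrt 2) *\<^sub>R (ket a + ket b)"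

definition psi_y2 :: "'n::finite \<Rightarrow> 'n \<Rightarrow> complex ^ 'n" where
  "psi_y2 a b = (1 / sqrt 2) *\<^sub>R (ket a + \<i> *s ket b)"

definition psi_x3 :: "'n::finite \<Rightarrow> 'n \<Rightarrow> 'n \<Rightarrow> complex ^ 'n" where
  "psi_x3 a b c = (1 / sqrt 3) *\<^sub>R (ket a + ket b + ket c)"

definition psi_y3 :: "'n::finite \<Rightarrow> 'n \<Rightarrow> 'n \<Rightarrow> complex ^ 'n" where
  "psi_y3 a b c = (1 / sqrt 3) *\<^sub>R (ket a + \<i> *s ket b + \<i> *s ket c)"

definition projections :: "('n::{finite, linorder}) cmat set" where
  "projections =
     {rank_one_proj (ket a) | a. True} \<union>
     {rank_one_proj (psi_x2 a b) | a b. a < b} \<union>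
     {rank_one_proj (psi_y2 a b) | a b. a < b} \<union>
     {rank_one_proj (psi_x3 a b c) | a b c. a < b \<and> b < c} \<union>
     {rank_one_proj (psi_y3 a b c) | a b c. a < b \<and> b < c} \<union>
     {rank_one_proj (psi_y3 c b a) | a b c. a < b \<and> b < c}"

end

theory Submission
  imports Defs
begin

text \<open>Let \<open>r \<pi>\<close> and \<open>e \<pi>\<close> be the state and the measurement operator of an equivalent physical
  representation in the places where the given one has \<open>\<pi>\<close>. They reproduce the overlaps
  \<open>trace (\<pi> ** \<pi>')\<close>. Since an effect with expectation \<open>1\<close> or \<open>0\<close> fixes or kills the support of
  the state, the \<open>d\<^sub>H\<close> basis projections go to those of another orthonormal basis; then every \<open>e \<pi>\<close>
  has trace \<open>1\<close>, hence \<open>e \<pi> = r \<pi>\<close> has rank one. The remaining freedom is one phase and one sign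
  per pair of basis vectors, and the three-index projections reduce it to a diagonal unitary and
  one global sign, that is, a transposition. As the one- and two-index projections span the
  matrix space, all states, maps and measurement operators are then determined by their
  probabilities.\<close>

section \<open>Matrix algebra\<close>

lemma trace_mult: "trace (A ** B) = (\<Sum>i\<in>UNIV. \<Sum>j\<in>UNIV. A $ i $ j * B $ j $ i)"
  by (simp add: trace_def matrix_matrix_mult_def)

lemma trace_zero [simp]: "trace 0 = 0"
  by (simp add: trace_def)

lemma matrix_diff_ldistrib: "A ** (B - C) = A ** B - A ** (C :: 'a::comm_ring_1 ^ 'n ^ 'm)"
  by (simp add: vec_eq_iff matrix_matrix_mult_def right_diff_distrib sum_subtractf)

lemma matrix_diff_rdistrib: "(A - B) ** C = A ** C - B ** (C :: 'a::comm_ring_1 ^ 'n ^ 'm)"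
  by (simp add: vec_eq_iff matrix_matrix_mult_def left_diff_distrib sum_subtractf)

lemma trace_transpose: "trace (transpose A) = trace A"
  by (simp add: trace_def transpose_def)

lemma trace_mat_scale: "trace (mat_scale c A) = c * trace A"
  by (simp add: trace_def mat_scale_def sum_distrib_left)

lemma transpose_add: "transpose (A + B) = transpose A + transpose B"
  by (simp add: transpose_def vec_eq_iff)

lemma transpose_mat_scale: "transpose (mat_scale c A) = mat_scale c (transpose A)"
  by (simp add: transpose_def mat_scale_def vec_eq_iff)

lemma mat_adjoint_nth [simp]: "mat_adjoint A $ a $ b = cnj (A $ b $ a)"
  by (simp add: mat_adjoint_def)

lemma mat_adjoint_mat_adjoint [simp]: "mat_adjoint (mat_adjoint A) = A"
  by (simp add: vec_eq_iff)

lemma mat_adjoint_mult: "mat_adjoint (A ** B) = mat_adjoint B ** mat_adjoint A"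
  by (simp add: vec_eq_iff matrix_matrix_mult_def mult.commute)

lemma mat_adjoint_transpose: "mat_adjoint (transpose A) = transpose (mat_adjoint A)"
  by (simp add: vec_eq_iff transpose_def)

lemma mat_adjoint_diff: "mat_adjoint (A - B) = mat_adjoint A - mat_adjoint B"
  by (simp add: vec_eq_iff)

lemma mat_adjoint_mat_1 [simp]: "mat_adjoint (mat 1) = mat 1"
  by (simp add: vec_eq_iff mat_def)

lemma rank_one_proj_nth: "rank_one_proj v $ a $ b = v $ a * cnj (v $ b)"
  by (simp add: rank_one_proj_def)

lemma hermitian_nth: "hermitian A \<Longrightarrow> cnj (A $ a $ b) = A $ b $ a"
  unfolding hermitian_def by (metis mat_adjoint_nth)

lemma hermitian_rank_one_proj: "hermitian (rank_one_proj v)"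
  by (simp add: hermitian_def vec_eq_iff rank_one_proj_nth)

lemma cinner_mult_left: "cinner (A *v v) w = cinner v (mat_adjoint A *v w)"
  unfolding cinner_def matrix_vector_mult_def
  by (simp add: sum_distrib_left sum_distrib_right, subst sum.swap) (simp add: algebra_simps)

lemma cinner_mult_right: "cinner v (A *v w) = cinner (mat_adjoint A *v v) w"
  by (simp add: cinner_mult_left)

lemma cinner_ket: "cinner (ket a) v = v $ a"
  by (simp add: cinner_def axis_def if_distrib [of cnj] if_distrib [of "\<lambda>x. x * _"] cong: if_cong)

lemma mult_ket: "(A *v ket b) $ a = (A $ a $ b :: complex)"
  by (simp add: matrix_vector_mult_def axis_def if_distrib [of "\<lambda>x. _ * x"] cong: if_cong)

lemma cinner_self: "cinner v v = of_real (\<Sum>a\<in>UNIV. (cmod (v $ a))\<^sup>2)"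
  unfolding cinner_def of_real_sum by (metis complex_norm_square mult.commute)

lemma cinner_self_Re: "cinner v v = of_real (Re (cinner v v))"
  by (simp add: cinner_self)

lemma cinner_self_nonneg: "0 \<le> Re (cinner v v)"
  by (simp add: cinner_self sum_nonneg)

lemma cinner_self_eq_0_iff: "cinner v v = 0 \<longleftrightarrow> v = 0"
  unfolding cinner_self of_real_eq_0_iff
  by (subst sum_nonneg_eq_0_iff) (auto simp: vec_eq_iff)

lemma trace_rank_one_proj: "trace (rank_one_proj v) = cinner v v"
  by (simp add: trace_def cinner_def rank_one_proj_nth mult.commute)

lemma trace_mult_rank_one_proj: "trace (A ** rank_one_proj v) = cinner v (A *v v)"
  by (simp add: trace_mult cinner_def rank_one_proj_nth matrix_vector_mult_def sum_distrib_left mult_ac)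

lemma mult_rank_one_proj: "A ** rank_one_proj v = (\<chi> i j. (A *v v) $ i * cnj (v $ j))"
  by (simp add: vec_eq_iff matrix_matrix_mult_def matrix_vector_mult_def rank_one_proj_nth
      sum_distrib_right mult.assoc)

text \<open>Compression to a line is a scalar. With \<open>A = mat 1\<close> and a unit vector
  \<open>v\<close> this yields idempotence.\<close>

lemma rank_one_proj_mult_rank_one_proj:
  "rank_one_proj v ** A ** rank_one_proj v = mat_scale (cinner v (A *v v)) (rank_one_proj v)"
proof -
  have "(rank_one_proj v *v w) $ i = cinner v w * v $ i" for w i
    by (simp add: matrix_vector_mult_def cinner_def rank_one_proj_nth sum_distrib_left mult_ac)
  then show ?thesis
    unfolding matrix_mul_assoc [symmetric] mult_rank_one_proj [of A]
    by (simp add: vec_eq_iff matrix_matrix_mult_def mat_scale_def cinner_def rank_one_proj_nth sum_distrib_right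
        sum_distrib_left mult_ac)
qed

lemma rank_one_proj_ket: "rank_one_proj (ket a) = mat_unit a a"
  by (auto simp: vec_eq_iff mat_unit_def axis_def rank_one_proj_nth)

section \<open>Positive semidefinite matrices\<close>

lemma pos_semidef_hermitian: "pos_semidef A \<Longrightarrow> hermitian A"
  by (simp add: pos_semidef_def)

lemma pos_semidef_congruence:
  assumes "pos_semidef A"
  shows "pos_semidef (mat_adjoint C ** A ** C)"
proof -
  have "cinner v ((mat_adjoint C ** A ** C) *v v) = cinner (C *v v) (A *v (C *v v))" for v
    by (simp add: cinner_mult_left matrix_vector_mul_assoc matrix_mul_assoc)
  then show ?thesis
    using assms by (simp add: pos_semidef_def hermitian_def mat_adjoint_mult matrix_mul_assoc)
qed

text \<open>If \<open>A *v v\<close> were nonzero, a short move from \<open>v\<close> against it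
  would make the quadratic form negative, since the term linear in \<open>t\<close> dominates for
  small \<open>t\<close>.\<close>

lemma pos_semidef_kernel:
  assumes A: "pos_semidef A" and v: "Re (cinner v (A *v v)) = 0"
  shows "A *v v = 0"
proof -
  define w where "w = A *v v"
  define W where "W = Re (cinner w w)"
  define c where "c = Re (cinner w (A *v w))"
  have c: "c \<ge> 0" and adj: "mat_adjoint A = A"
    using A by (simp_all add: c_def pos_semidef_def hermitian_def)
  have W: "W \<ge> 0"
    by (simp add: W_def cinner_self_nonneg)
  have vw: "cinner v (A *v w) = cinner w w"
    by (simp add: cinner_mult_right adj w_def)
  have lin: "cinner (x - of_real t *s y) (A *v (x - of_real t *s y)) =
      cinner x (A *v x) - of_real t * cinner x (A *v y) - of_real t * cinner y (A *v x)
      + of_real (t\<^sup>2) * cinner y (A *v y)" for x y t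
    unfolding matrix_vector_mult_diff_distrib vector_scalar_commute
    by (simp add: cinner_def algebra_simps sum.distrib sum_subtractf sum_distrib_left power2_eq_square)
  have "0 \<le> - 2 * t * W + t\<^sup>2 * c" for t
  proof -
    have "0 \<le> Re (cinner (v - of_real t *s w) (A *v (v - of_real t *s w)))"
      using A by (simp add: pos_semidef_def)
    then show ?thesis
      unfolding lin vw using v by (simp add: W_def c_def w_def [symmetric])
  qed
  \<comment> \<open>The parabola has its minimum at \<open>t = W / c\<close>. The denominator
    \<open>c + 1\<close> stays positive when \<open>c = 0\<close>, and the value there is still
    negative unless \<open>W = 0\<close>.\<close>
  from this [of "W / (c + 1)"] have "0 \<le> (- 2 * (W / (c + 1)) * W + (W / (c + 1))\<^sup>2 * c) * (c + 1)\<^sup>2"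
    by simp
  also have "\<dots> = - (W\<^sup>2 * (c + 2))"
    using c by (simp add: divide_simps) (simp add: power2_eq_square algebra_simps)
  finally have "W\<^sup>2 * (c + 2) \<le> 0"
    by simp
  then have "W = 0"
    using c by (simp add: mult_le_0_iff)
  then show ?thesis
    using cinner_self_Re [of w] by (simp add: W_def w_def cinner_self_eq_0_iff)
qed

section \<open>Diagonals and rank-one decompositions\<close>

lemma pos_semidef_diag:
  assumes "pos_semidef A"
  shows "Im (A $ a $ a) = 0" "0 \<le> Re (A $ a $ a)"
proof -
  show "Im (A $ a $ a) = 0"
    using hermitian_nth [OF pos_semidef_hermitian [OF assms], of a a]
    by (simp add: complex_eq_iff)
  have "0 \<le> Re (cinner (ket a) (A *v ket a))"
    using assms by (simp add: pos_semidef_def)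
  then show "0 \<le> Re (A $ a $ a)"
    by (simp add: cinner_ket mult_ket)
qed

text \<open>The quadratic form vanishes at \<open>ket a\<close>, so the column
  \<open>A *v ket a\<close> vanishes, and by hermiticity so does the row.\<close>

lemma pos_semidef_diag_0:
  assumes "pos_semidef A" "A $ a $ a = 0"
  shows "A $ b $ a = 0" "A $ a $ b = 0"
proof -
  have "A *v ket a = 0"
    using assms by (intro pos_semidef_kernel) (simp_all add: cinner_ket mult_ket)
  then show "A $ b $ a = 0"
    by (metis mult_ket zero_index)
  then show "A $ a $ b = 0"
    using hermitian_nth [OF pos_semidef_hermitian [OF assms(1)], of b a] by simp
qed

text \<open>The diagonal is nonnegative with sum zero; it vanishes and takes every column with
  it.\<close>

lemma pos_semidef_eq_0:
  assumes "pos_semidef A" "trace A = 0"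
  shows "A = 0"
proof -
  have "(\<Sum>a\<in>UNIV. Re (A $ a $ a)) = 0"
    using assms(2) by (simp add: trace_def flip: Re_sum)
  then have "Re (A $ a $ a) = 0" for a
    by (subst (asm) sum_nonneg_eq_0_iff) (auto simp: pos_semidef_diag(2) [OF assms(1)])
  then have "A $ a $ a = 0" for a
    using pos_semidef_diag(1) [OF assms(1), of a] by (simp add: complex_eq_iff)
  then have "A $ b $ a = 0" for a b
    using pos_semidef_diag_0(1) [OF assms(1)] by blast
  then show ?thesis
    by (simp add: vec_eq_iff)
qed

text \<open>Cholesky decomposition: splitting off the rank-one matrix of a normalized column leaves the
  Schur complement, which is congruent to \<open>A\<close> and has one more vanishing row and column.\<close>

lemma pos_semidef_sum_rank_one_proj:
  assumes "pos_semidef A"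
  shows "\<exists>vs. A = sum_list (map rank_one_proj vs)"
  using assms
proof (induction "card {a. A $ a $ a \<noteq> 0}" arbitrary: A rule: less_induct)
  case less
  note A = less.prems
  show ?case
  proof (cases "\<exists>a. A $ a $ a \<noteq> 0")
    case False
    then have "A $ i $ j = 0" for i j
      using pos_semidef_diag_0(1) [OF A] by blast
    then have "A = sum_list (map rank_one_proj [])"
      by (simp add: vec_eq_iff)
    then show ?thesis
      by blast
  next
    case True
    then obtain a where a: "A $ a $ a \<noteq> 0"
      by blast
    define d where "d = Re (A $ a $ a)"
    have d: "A $ a $ a = of_real d" "d > 0"
      using a pos_semidef_diag [OF A, of a] by (auto simp: d_def order_less_le complex_eq_iff)
    define v where "v = (1 / sqrt d) *\<^sub>R (A *v ket a)"
    define C where "C = (\<chi> i j. (if i = j then 1 else 0) - (if i = a then A $ a $ j / d else 0))"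
    \<comment> \<open>\<open>A ** C\<close> is already the Schur complement. As its row
      \<open>a\<close> vanishes, the left factor changes no entry; it exhibits \<open>B\<close> as
      congruent to \<open>A\<close>, hence positive semidefinite.\<close>
    define B where "B = mat_adjoint C ** A ** C"
    have AC: "(A ** C) $ i $ j = A $ i $ j - A $ i $ a * A $ a $ j / d" for i j
      by (simp add: C_def matrix_matrix_mult_def right_diff_distrib sum_subtractf
          if_distrib [of "\<lambda>x. _ * x"] cong: if_cong)
    have "B $ i $ j = (A ** C) $ i $ j - cnj (A $ a $ i) / d * (A ** C) $ a $ j" for i j
      unfolding B_def matrix_mul_assoc [symmetric]
      by (subst matrix_matrix_mult_def)
        (simp add: C_def left_diff_distrib sum_subtractf if_distrib [of "\<lambda>x. x * _"]
          if_distrib [of cnj] cong: if_cong)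
    then have B: "B $ i $ j = A $ i $ j - A $ i $ a * A $ a $ j / d" for i j
      using d by (simp add: AC)
    have v: "rank_one_proj v $ i $ j = A $ i $ a * A $ a $ j / d" for i j
    proof -
      have "complex_of_real (sqrt d) * complex_of_real (sqrt d) = d"
        using d by (simp flip: of_real_mult)
      then show ?thesis
        unfolding v_def rank_one_proj_nth vector_scaleR_component mult_ket
        by (simp add: scaleR_conv_of_real hermitian_nth [OF pos_semidef_hermitian [OF A]])
    qed
    have "card {b. B $ b $ b \<noteq> 0} < card {b. A $ b $ b \<noteq> 0}"
    proof (rule psubset_card_mono)
      have "B $ b $ b = 0" if "A $ b $ b = 0" for b
        using pos_semidef_diag_0 [OF A that] that by (simp add: B)
      moreover have "B $ a $ a = 0"
        using d by (simp add: B)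
      ultimately show "{b. B $ b $ b \<noteq> 0} \<subset> {b. A $ b $ b \<noteq> 0}"
        using a by auto
    qed simp
    from less.hyps [OF this] obtain vs where "B = sum_list (map rank_one_proj vs)"
      using pos_semidef_congruence [OF A] unfolding B_def by blast
    moreover have "A = rank_one_proj v + B"
      by (simp add: vec_eq_iff B v)
    ultimately have "A = sum_list (map rank_one_proj (v # vs))"
      by simp
    then show ?thesis
      by blast
  qed
qed

text \<open>Over a rank-one decomposition of \<open>R\<close> the trace is a sum of the nonnegative
  numbers \<open>cinner v (E *v v)\<close>. Each of them is zero, so \<open>E\<close> kills every
  \<open>v\<close>.\<close>

lemma pos_semidef_mult_eq_0:
  assumes E: "pos_semidef E" and R: "pos_semidef R" and tr: "trace (E ** R) = 0"
  shows "E ** R = 0"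
proof -
  obtain vs where vs: "R = sum_list (map rank_one_proj vs)"
    using pos_semidef_sum_rank_one_proj [OF R] by blast
  have sum: "E ** sum_list (map f vs) = (\<Sum>v\<leftarrow>vs. E ** f v)" for f :: "complex ^ 'a \<Rightarrow> 'a cmat" and vs
    by (induction vs) (simp_all add: matrix_add_ldistrib)
  have tr_sum: "trace (sum_list (map f vs)) = (\<Sum>v\<leftarrow>vs. trace (f v))"
    for f :: "complex ^ 'a \<Rightarrow> 'a cmat" and vs
    by (induction vs) (simp_all add: trace_add)
  have "(\<Sum>v\<leftarrow>vs. cinner v (E *v v)) = 0"
    using tr by (simp add: vs sum tr_sum trace_mult_rank_one_proj)
  moreover have "Re (\<Sum>v\<leftarrow>vs. f v) = (\<Sum>v\<leftarrow>vs. Re (f v))" for f :: "complex ^ 'a \<Rightarrow> complex" and vs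
    by (induction vs) simp_all
  ultimately have "(\<Sum>v\<leftarrow>vs. Re (cinner v (E *v v))) = 0"
    by (metis zero_complex.sel(1))
  then have "Re (cinner v (E *v v)) = 0" if "v \<in> set vs" for v
    using that E by (subst (asm) sum_list_nonneg_eq_0_iff) (auto simp: pos_semidef_def)
  then have "E *v v = 0" if "v \<in> set vs" for v
    using that pos_semidef_kernel [OF E] by blast
  then have "E ** rank_one_proj v = 0" if "v \<in> set vs" for v
    using that by (simp add: mult_rank_one_proj vec_eq_iff)
  then have "(\<Sum>v\<leftarrow>vs. E ** rank_one_proj v) = 0"
    by (induction vs) simp_all
  then show ?thesis
    by (simp add: vs sum)
qed

text \<open>The complementary effect \<open>mat 1 - E\<close> has expectation \<open>0\<close>, so
  it annihilates the state.\<close>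

lemma effect_mult_state:
  assumes "pos_semidef (mat 1 - E)" "pos_semidef R" "trace R = 1" "trace (E ** R) = 1"
  shows "E ** R = R"
proof -
  have "(mat 1 - E) ** R = R - E ** R"
    by (simp add: matrix_diff_rdistrib)
  moreover from this have "(mat 1 - E) ** R = 0"
    using assms by (intro pos_semidef_mult_eq_0) (simp_all add: trace_sub)
  ultimately show ?thesis
    by simp
qed

text \<open>The state may be mixed; any nonzero column of it, normalized, serves as
  \<open>v\<close>. As \<open>E *v v\<close> is a multiple of a column of \<open>E ** R\<close>, one
  \<open>v\<close> works for all \<open>E\<close> at once.\<close>

lemma state_eigenvector:
  assumes "trace R = 1" "hermitian R"
  shows "\<exists>v. cinner v v = 1 \<and>
    (\<forall>E. (E ** R = R \<longrightarrow> E *v v = v) \<and> (E ** R = 0 \<longrightarrow> E *v v = 0))"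
proof -
  have "R \<noteq> 0"
    using assms(1) by auto
  then obtain a b where "R $ a $ b \<noteq> 0"
    by (auto simp: vec_eq_iff)
  then have w: "R *v ket b \<noteq> 0"
    by (metis mult_ket zero_index)
  define w where "w = R *v ket b"
  define s where "s = sqrt (Re (cinner w w))"
  have "cinner w w \<noteq> 0"
    using w by (simp add: w_def cinner_self_eq_0_iff)
  then have s: "of_real (s\<^sup>2) = cinner w w" "s \<noteq> 0"
    using cinner_self_Re [of w] cinner_self_nonneg [of w] by (auto simp: s_def)
  define v where "v = of_real (1 / s) *s w"
  have Ev: "E *v v = of_real (1 / s) *s ((E ** R) *v ket b)" for E
    unfolding v_def w_def by (simp only: vector_scalar_commute matrix_vector_mul_assoc)
  show ?thesis
  proof (intro exI conjI)
    have "cinner v v = of_real (1 / s) * of_real (1 / s) * cinner w w"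
      by (simp add: v_def cinner_def sum_distrib_left mult_ac)
    then show "cinner v v = 1"
      using s by (simp flip: s(1) add: power2_eq_square)
  qed (simp_all add: Ev, simp add: v_def w_def)
qed

text \<open>A unit vector in the range of \<open>R\<close> is fixed by \<open>E\<close>. Removing
  its projection from \<open>E\<close> leaves a positive semidefinite matrix of trace
  \<open>0\<close>, so \<open>E\<close> is that projection. Then \<open>R\<close> is supported on
  the same line and has the same trace.\<close>

lemma pure_state:
  assumes E: "pos_semidef E" "trace E = 1" and R: "pos_semidef R" "trace R = 1"
    and ER: "E ** R = R"
  obtains v where "E = rank_one_proj v" "R = E"
proof -
  obtain v where v: "cinner v v = 1" "E *v v = v"
    using state_eigenvector [OF R(2) pos_semidef_hermitian [OF R(1)]] ER by blast
  define P where "P = rank_one_proj v"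
  have adj: "mat_adjoint P = P" "mat_adjoint E = E" "mat_adjoint R = R"
    using hermitian_rank_one_proj [of v] E R by (simp_all add: P_def hermitian_def pos_semidef_def)
  have EP: "E ** P = P"
    using v by (simp add: P_def mult_rank_one_proj vec_eq_iff rank_one_proj_nth)
  then have PE: "P ** E = P"
    by (metis adj(1,2) mat_adjoint_mult)
  have PP: "P ** P = P"
    using rank_one_proj_mult_rank_one_proj [of v "mat 1"] v
    by (simp add: P_def mat_scale_def vec_eq_iff)
  define C where "C = mat 1 - P"
  have "mat_adjoint C ** E ** C = E - P"
    unfolding C_def mat_adjoint_diff adj mat_adjoint_mat_1
    by (simp add: matrix_diff_ldistrib matrix_diff_rdistrib EP PE PP)
  moreover have "trace (E - P) = 0"
    using E v by (simp add: trace_sub P_def trace_rank_one_proj)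
  ultimately have EqP: "E = P"
    using pos_semidef_eq_0 [OF pos_semidef_congruence [OF E(1), of C]] by simp
  \<comment> \<open>The adjoint of \<open>E ** R = R\<close> is \<open>R ** E = R\<close>, so
    \<open>P\<close> can be put on both sides.\<close>
  then have "R = P ** R ** P"
    using ER by (metis adj(1,3) mat_adjoint_mult)
  then have RP: "R = mat_scale (cinner v (R *v v)) P"
    unfolding P_def using rank_one_proj_mult_rank_one_proj by metis
  then have "trace R = cinner v (R *v v) * trace P"
    using trace_mat_scale by metis
  then have "R = P"
    using RP R(2) v by (simp add: P_def trace_rank_one_proj mat_scale_def vec_eq_iff)
  with EqP that show ?thesis
    by (simp add: P_def)
qed

section \<open>Unitary and antiunitary maps\<close>

text \<open>The flag \<open>t\<close> lets one proof cover the unitary and the antiunitary case.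
  Transposition comes first here, so that conjugations by unitaries compose on the left.\<close>

definition symmetry :: "bool \<Rightarrow> ('n::finite) cmat \<Rightarrow> 'n cmat \<Rightarrow> 'n cmat" where
  "symmetry t u X = u ** (if t then transpose X else X) ** mat_adjoint u"

text \<open>For \<open>t\<close> true, undoing the conjugation and then transposing is transposing
  first and then conjugating by \<open>transpose u\<close>.\<close>

definition symmetry_inv :: "bool \<Rightarrow> ('n::finite) cmat \<Rightarrow> 'n cmat" where
  "symmetry_inv t u = (if t then transpose u else mat_adjoint u)"

lemma unitary_mat_adjoint: "unitary_mat u \<Longrightarrow> unitary_mat (mat_adjoint u)"
  by (simp add: unitary_mat_def)

lemma unitary_mat_transpose:
  assumes "unitary_mat u"
  shows "unitary_mat (transpose u)"
  using assms unfolding unitary_mat_def mat_adjoint_transpose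
  by (metis matrix_transpose_mul transpose_mat)

lemma unitary_mat_mult: "unitary_mat u \<Longrightarrow> unitary_mat v \<Longrightarrow> unitary_mat (u ** v)"
  unfolding unitary_mat_def mat_adjoint_mult by (metis matrix_mul_assoc matrix_mul_lid)

lemma unitary_mat_symmetry_inv: "unitary_mat u \<Longrightarrow> unitary_mat (symmetry_inv t u)"
  by (simp add: symmetry_inv_def unitary_mat_adjoint unitary_mat_transpose)

lemma symmetry_inv_symmetry_inv [simp]: "symmetry_inv t (symmetry_inv t u) = u"
  by (simp add: symmetry_inv_def)

lemma symmetry_symmetry_inv:
  assumes "unitary_mat u"
  shows "symmetry t u (symmetry t (symmetry_inv t u) X) = X"
proof -
  have u: "u ** (mat_adjoint u ** B) = B" for B :: "'a cmat"
    using assms by (simp add: matrix_mul_assoc unitary_mat_def)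
  have "symmetry t u (symmetry t (symmetry_inv t u) X) = u ** (mat_adjoint u ** X ** u) ** mat_adjoint u"
    by (cases t) (simp_all add: symmetry_def symmetry_inv_def matrix_transpose_mul
        mat_adjoint_transpose matrix_mul_assoc)
  then show ?thesis
    using u assms by (simp flip: matrix_mul_assoc) (simp add: unitary_mat_def)
qed

lemma symmetry_inv_symmetry:
  "unitary_mat u \<Longrightarrow> symmetry t (symmetry_inv t u) (symmetry t u X) = X"
  using symmetry_symmetry_inv [OF unitary_mat_symmetry_inv [of u t], of t X] by simp

lemma inv_symmetry:
  assumes "unitary_mat u"
  shows "inv (symmetry t u) = symmetry t (symmetry_inv t u)"
  by (rule inv_unique_comp)
    (simp_all add: fun_eq_iff symmetry_symmetry_inv symmetry_inv_symmetry assms)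

lemma symmetry_add: "symmetry t u (X + Y) = symmetry t u X + symmetry t u Y"
  by (simp add: symmetry_def transpose_add matrix_add_ldistrib)
    (simp add: matrix_add_ldistrib matrix_matrix_mult_def vec_eq_iff sum.distrib algebra_simps)

lemma symmetry_mat_scale: "symmetry t u (mat_scale c X) = mat_scale c (symmetry t u X)"
proof -
  have "u ** mat_scale c X ** v = mat_scale c (u ** X ** v)" for X v
    by (simp add: matrix_matrix_mult_def mat_scale_def vec_eq_iff sum_distrib_left
        sum_distrib_right mult_ac)
  then show ?thesis
    by (simp add: symmetry_def transpose_mat_scale)
qed

lemma mat_linear_symmetry: "mat_linear (symmetry t u)"
  by (simp add: mat_linear_iff symmetry_add symmetry_mat_scale)

lemma symmetry_diff: "symmetry t u (X - Y) = symmetry t u X - symmetry t u Y"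
  using symmetry_add [of t u "X - Y" Y] by (simp add: algebra_simps)

lemma symmetry_mat_1: "unitary_mat u \<Longrightarrow> symmetry t u (mat 1) = mat 1"
  by (simp add: symmetry_def unitary_mat_def)

lemma trace_symmetry_mult:
  assumes "unitary_mat u"
  shows "trace (symmetry t u A ** symmetry t u B) = trace (A ** B)"
proof -
  have *: "trace (u ** X ** mat_adjoint u ** (u ** Y ** mat_adjoint u)) = trace (X ** Y)" for X Y
  proof -
    have eq: "u ** X ** mat_adjoint u ** (u ** Y ** mat_adjoint u) =
        u ** (X ** (mat_adjoint u ** u) ** Y ** mat_adjoint u)"
      by (simp add: matrix_mul_assoc)
    have "trace (u ** X ** mat_adjoint u ** (u ** Y ** mat_adjoint u)) =
        trace ((X ** (mat_adjoint u ** u) ** Y ** mat_adjoint u) ** u)"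
      unfolding eq by (rule trace_mul_sym)
    also have "(X ** (mat_adjoint u ** u) ** Y ** mat_adjoint u) ** u =
        X ** (mat_adjoint u ** u) ** Y ** (mat_adjoint u ** u)"
      by (simp add: matrix_mul_assoc)
    finally show ?thesis
      using assms by (simp add: unitary_mat_def)
  qed
  have "trace (transpose A ** transpose B) = trace (A ** B)"
    by (metis matrix_transpose_mul trace_mul_sym trace_transpose)
  then show ?thesis
    by (simp add: symmetry_def *)
qed

lemma trace_symmetry: "unitary_mat u \<Longrightarrow> trace (symmetry t u A) = trace A"
  using trace_symmetry_mult [of u t A "mat 1"] by (simp add: symmetry_mat_1)

text \<open>A symmetry preserves the bilinear form \<open>trace (A ** B)\<close>, so its dual is its
  inverse. Hence measurement operators are transformed exactly like states.\<close>

lemma dual_map_symmetry: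
  assumes "unitary_mat u"
  shows "dual_map (symmetry t u) = symmetry t (symmetry_inv t u)"
  by (rule dual_map_eqI) (metis assms symmetry_symmetry_inv trace_symmetry_mult)

text \<open>Transposition becomes complex conjugation of the vectors, with their roles exchanged; on
  a single vector it therefore preserves nonnegativity of the quadratic form.\<close>

lemma cinner_transpose_mult:
  "cinner v (transpose A *v w) = cinner (\<chi> a. cnj (w $ a)) (A *v (\<chi> a. cnj (v $ a)))"
  unfolding cinner_def matrix_vector_mult_def transpose_def
  by (simp add: sum_distrib_left, subst sum.swap) (simp add: mult_ac)

lemma pos_semidef_symmetry:
  assumes "pos_semidef A"
  shows "pos_semidef (symmetry t u A)"
proof -
  have "pos_semidef (transpose A)"
    using assms by (simp add: pos_semidef_def hermitian_def mat_adjoint_transpose cinner_transpose_mult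
        del: transpose_matrix_vector)
  then show ?thesis
    using assms pos_semidef_congruence [of _ "mat_adjoint u"] by (simp add: symmetry_def)
qed

text \<open>Transposing every block alone is a partial transpose, which need not preserve positivity;
  the block indices have to be exchanged as well.\<close>

lemma block_pos_semidef_symmetry:
  assumes "block_pos_semidef k X"
  shows "block_pos_semidef k (\<lambda>p q. symmetry t u (if t then X q p else X p q))"
proof -
  define w where "w v p = mat_adjoint u *v v p" for v :: "nat \<Rightarrow> complex ^ 'a" and p
  define w' where "w' v p = (\<chi> a. cnj (w v p $ a))" for v :: "nat \<Rightarrow> complex ^ 'a" and p
  have herm: "mat_adjoint (X p q) = X q p" if "p < k" "q < k" for p q
    using assms that by (simp add: block_pos_semidef_def)
  have nonneg: "0 \<le> Re (\<Sum>p<k. \<Sum>q<k. cinner (v p) (X p q *v v q))" for v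
    using assms by (simp add: block_pos_semidef_def)
  have conj: "cinner (v p) ((u ** Y ** mat_adjoint u) *v v q) = cinner (w v p) (Y *v w v q)"
    for v p q and Y :: "'a cmat"
    by (simp add: w_def cinner_mult_left matrix_vector_mul_assoc matrix_mul_assoc)
  have "(\<Sum>p<k. \<Sum>q<k. cinner (v p) (symmetry t u (if t then X q p else X p q) *v v q)) =
      (if t then \<Sum>p<k. \<Sum>q<k. cinner (w' v p) (X p q *v w' v q)
       else \<Sum>p<k. \<Sum>q<k. cinner (w v p) (X p q *v w v q))" for v
  proof (cases t)
    case True
    have "(\<Sum>p<k. \<Sum>q<k. cinner (v p) (symmetry t u (X q p) *v v q)) =
        (\<Sum>p<k. \<Sum>q<k. cinner (w' v q) (X q p *v w' v p))"
      using True by (simp add: symmetry_def conj cinner_transpose_mult w'_def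
          del: transpose_matrix_vector)
    then show ?thesis
      using True sum.swap by fastforce
  qed (simp add: symmetry_def conj)
  moreover have "mat_adjoint (symmetry t u (if t then X q p else X p q)) =
      symmetry t u (if t then X p q else X q p)" if "p < k" "q < k" for p q
    using that by (cases t)
      (simp_all add: symmetry_def mat_adjoint_mult mat_adjoint_transpose herm matrix_mul_assoc)
  ultimately show ?thesis
    using nonneg by (simp add: block_pos_semidef_def)
qed

text \<open>With the same flag on both sides, the exchange of block indices caused by the inner
  symmetry is undone by the outer one. So conjugation by an antiunitary preserves complete
  positivity although transposition is not completely positive in general.\<close>

lemma completely_positive_symmetry:
  assumes "completely_positive M"
  shows "completely_positive (symmetry t u \<circ> M \<circ> symmetry t v)"
  unfolding completely_positive_def
proof (intro conjI allI impI)
  have M: "mat_linear M"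
    using assms by (simp add: completely_positive_def)
  then show "mat_linear (symmetry t u \<circ> M \<circ> symmetry t v)"
    using mat_linear_symmetry [of t u] mat_linear_symmetry [of t v] by (simp add: mat_linear_iff)
  fix k X assume "block_pos_semidef k (X :: nat \<Rightarrow> nat \<Rightarrow> 'a cmat)"
  then have "block_pos_semidef k (\<lambda>p q. M (symmetry t v (if t then X q p else X p q)))"
    using assms block_pos_semidef_symmetry unfolding completely_positive_def by blast
  from block_pos_semidef_symmetry [OF this, of t u]
  show "block_pos_semidef k (\<lambda>p q. (symmetry t u \<circ> M \<circ> symmetry t v) (X p q))"
    by (cases t) simp_all
qed

text \<open>Moving the transposition from after a conjugation to before it replaces the unitary by
  its entrywise complex conjugate, which is again unitary.\<close>

lemma symmetry_maps_eq: "symmetry_maps = {symmetry t u | t u. unitary_mat u}"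
proof (intro set_eqI iffI)
  fix S assume "S \<in> symmetry_maps"
  then obtain u where u: "unitary_mat u"
    and S: "S = (\<lambda>X. u ** X ** mat_adjoint u) \<or> S = transpose \<circ> (\<lambda>X. u ** X ** mat_adjoint u)"
    by (auto simp: symmetry_maps_def unitary_maps_def)
  have "(\<lambda>X. u ** X ** mat_adjoint u) = symmetry False u"
    by (simp add: symmetry_def fun_eq_iff)
  moreover have "transpose \<circ> (\<lambda>X. u ** X ** mat_adjoint u) = symmetry True (transpose (mat_adjoint u))"
    by (simp add: symmetry_def fun_eq_iff matrix_transpose_mul mat_adjoint_transpose matrix_mul_assoc)
  ultimately show "S \<in> {symmetry t u | t u. unitary_mat u}"
    using S u unitary_mat_adjoint unitary_mat_transpose by blast
next
  fix S :: "'a cmat \<Rightarrow> 'a cmat" assume "S \<in> {symmetry t u | t u. unitary_mat u}"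
  then obtain t u where u: "unitary_mat u" and S: "S = symmetry t u"
    by blast
  define w where "w = mat_adjoint (transpose u)"
  have w: "unitary_mat w"
    by (simp add: w_def u unitary_mat_adjoint unitary_mat_transpose)
  have "S = (if t then transpose \<circ> (\<lambda>X. w ** X ** mat_adjoint w) else (\<lambda>X. u ** X ** mat_adjoint u))"
    by (simp add: S w_def symmetry_def fun_eq_iff matrix_transpose_mul mat_adjoint_transpose matrix_mul_assoc)
  then show "S \<in> symmetry_maps"
    using u w by (auto simp: symmetry_maps_def unitary_maps_def)
qed

section \<open>Action of the symmetries on representations\<close>

lemma transform_symmetry:
  assumes "unitary_mat u"
  shows "transform (symmetry t u) m =
    \<lparr>states = (\<lambda>i. map_option (symmetry t (symmetry_inv t u)) (states m i)),
     maps = (\<lambda>j. map_option (\<lambda>M. symmetry t (symmetry_inv t u) \<circ> M \<circ> symmetry t u) (maps m j)),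
     measurements = (\<lambda>k. map_option (symmetry t (symmetry_inv t u)) (measurements m k))\<rparr>"
  by (simp add: transform_def inv_symmetry dual_map_symmetry assms)

lemma physical_transform_symmetry:
  assumes "unitary_mat u" "physical m"
  shows "physical (transform (symmetry t u) m)"
proof -
  let ?V = "symmetry t (symmetry_inv t u)"
  have u': "unitary_mat (symmetry_inv t u)"
    by (simp add: assms unitary_mat_symmetry_inv)
  have "pos_semidef (?V \<rho>) \<and> trace (?V \<rho>) = 1" if "states m i = Some \<rho>" for i \<rho>
    using assms that u' by (auto simp: physical_def ran_def pos_semidef_symmetry trace_symmetry)
  moreover have "completely_positive (?V \<circ> M \<circ> symmetry t u) \<and> trace_preserving (?V \<circ> M \<circ> symmetry t u)"
    if "maps m j = Some M" for j M
    using assms that u'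
    by (auto simp: physical_def ran_def completely_positive_symmetry trace_preserving_def trace_symmetry)
  moreover have "pos_semidef (?V E) \<and> pos_semidef (mat 1 - ?V E)"
    if "measurements m k = Some E" for k E
    using assms that u' pos_semidef_symmetry [of "mat 1 - E" t "symmetry_inv t u"]
    by (auto simp: physical_def ran_def pos_semidef_symmetry symmetry_diff symmetry_mat_1)
  ultimately show ?thesis
    unfolding physical_def transform_symmetry [OF assms(1)] by (auto simp: ran_def)
qed

lemma same_prob_dist_transform_symmetry:
  assumes "unitary_mat u"
  shows "same_prob_dist (transform (symmetry t u) m) m"
proof -
  let ?V = "symmetry t (symmetry_inv t u)" and ?m = "transform (symmetry t u) m"
  have u': "unitary_mat (symmetry_inv t u)"
    by (simp add: assms unitary_mat_symmetry_inv)
  \<comment> \<open>Along a word of maps each inner symmetry cancels the inverse left by the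
    preceding map; one inverse remains outside.\<close>
  have fold: "fold (\<lambda>j. the (maps ?m j)) js (?V X) = ?V (fold (\<lambda>j. the (maps m j)) js X)"
    if "js \<in> lists (dom (maps m))" for js X
    using that
    by (induction js arbitrary: X) (auto simp: transform_symmetry symmetry_symmetry_inv assms)
  have "prob_dist ?m i js k = prob_dist m i js k"
    if "i \<in> dom (states m)" "js \<in> lists (dom (maps m))" "k \<in> dom (measurements m)" for i js k
  proof -
    obtain \<rho> E where "states m i = Some \<rho>" "measurements m k = Some E"
      using \<open>i \<in> dom (states m)\<close> \<open>k \<in> dom (measurements m)\<close> by blast
    moreover from this have "states ?m i = Some (?V \<rho>)" "measurements ?m k = Some (?V E)"
      by (simp_all add: transform_symmetry assms)
    ultimately show ?thesis
      by (simp add: prob_dist_def fold [OF that(2)] trace_symmetry_mult u')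
  qed
  then show ?thesis
    by (auto simp: same_prob_dist_def transform_symmetry assms dom_def)
qed

section \<open>Rigidity of the family of projections\<close>

text \<open>For dimension \<open>d\<close> these are \<open>d + d * (d - 1) = d * d\<close>
  matrices, a basis of the matrix space. The three-index projections serve to relate the phases of
  different pairs.\<close>

definition pair_projections :: "('n::{finite, linorder}) cmat set" where
  "pair_projections =
     {rank_one_proj (ket a) | a. True} \<union>
     {rank_one_proj (psi_x2 a b) | a b. a < b} \<union>
     {rank_one_proj (psi_y2 a b) | a b. a < b}"

lemma in_pair_projections:
  "rank_one_proj (ket a) \<in> pair_projections"
  "a < b \<Longrightarrow> rank_one_proj (psi_x2 a b) \<in> pair_projections"
  "a < b \<Longrightarrow> rank_one_proj (psi_y2 a b) \<in> pair_projections"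
  unfolding pair_projections_def by blast+

lemma pair_projections_subset: "pair_projections \<subseteq> projections"
  by (auto simp: pair_projections_def projections_def)

lemma rank_one_proj_scaleR: "rank_one_proj (r *\<^sub>R v) $ i $ j = of_real (r\<^sup>2) * (v $ i * cnj (v $ j))"
  unfolding rank_one_proj_nth vector_scaleR_component
  by (simp add: scaleR_conv_of_real power2_eq_square)

lemma psi_x2_nth:
  "rank_one_proj (psi_x2 a b) $ i $ j = (ket a + ket b) $ i * cnj ((ket a + ket b) $ j) / 2"
  unfolding psi_x2_def rank_one_proj_scaleR by (simp add: power_divide)

lemma psi_y2_nth:
  "rank_one_proj (psi_y2 a b) $ i $ j =
     (ket a + \<i> *s ket b) $ i * cnj ((ket a + \<i> *s ket b) $ j) / 2"
  unfolding psi_y2_def rank_one_proj_scaleR by (simp add: power_divide)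

lemma psi_x3_nth:
  "rank_one_proj (psi_x3 a b c) $ i $ j =
     (ket a + ket b + ket c) $ i * cnj ((ket a + ket b + ket c) $ j) / 3"
  unfolding psi_x3_def rank_one_proj_scaleR by (simp add: power_divide)

lemma psi_y3_nth:
  "rank_one_proj (psi_y3 a b c) $ i $ j =
     (ket a + \<i> *s ket b + \<i> *s ket c) $ i * cnj ((ket a + \<i> *s ket b + \<i> *s ket c) $ j) / 3"
  unfolding psi_y3_def rank_one_proj_scaleR by (simp add: power_divide)

lemmas psi_nth = psi_x2_nth psi_y2_nth psi_x3_nth psi_y3_nth axis_def

lemma in_projections:
  "rank_one_proj (ket a) \<in> projections"
  "a < b \<Longrightarrow> rank_one_proj (psi_x2 a b) \<in> projections"
  "a < b \<Longrightarrow> rank_one_proj (psi_y2 a b) \<in> projections"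
  "a < b \<Longrightarrow> b < c \<Longrightarrow> rank_one_proj (psi_x3 a b c) \<in> projections"
  "a < b \<Longrightarrow> b < c \<Longrightarrow> rank_one_proj (psi_y3 a b c) \<in> projections"
  "a < b \<Longrightarrow> b < c \<Longrightarrow> rank_one_proj (psi_y3 c b a) \<in> projections"
  unfolding projections_def by blast+

lemma projections_rank_one:
  assumes "\<pi> \<in> projections"
  shows "\<exists>v. \<pi> = rank_one_proj v"
  using assms unfolding projections_def by blast

lemma trace_projections:
  assumes "\<pi> \<in> projections"
  shows "trace \<pi> = 1"
proof -
  have tr: "trace A = (\<Sum>i\<in>S. A $ i $ i)" if "\<And>i. i \<notin> S \<Longrightarrow> A $ i $ i = 0" for A :: "'a cmat" and S
    unfolding trace_def using that by (intro sum.mono_neutral_right) auto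
  have "trace (rank_one_proj (ket a)) = 1" for a :: 'a
    by (subst tr [of "{a}"]) (auto simp: axis_def rank_one_proj_nth)
  moreover have "trace (rank_one_proj (psi_x2 a b)) = 1" "trace (rank_one_proj (psi_y2 a b)) = 1"
    if "a < b" for a b :: 'a
    using that by (subst tr [of "{a, b}"]; auto simp: psi_nth)+
  moreover have "trace (rank_one_proj (psi_x3 a b c)) = 1" "trace (rank_one_proj (psi_y3 a b c)) = 1"
      "trace (rank_one_proj (psi_y3 c b a)) = 1"
    if "a < b" "b < c" for a b c :: 'a
  proof -
    have "a \<noteq> b" "a \<noteq> c" "b \<noteq> c"
      using that by auto
    then show "trace (rank_one_proj (psi_x3 a b c)) = 1" "trace (rank_one_proj (psi_y3 a b c)) = 1"
      "trace (rank_one_proj (psi_y3 c b a)) = 1"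
      by (subst tr [of "{a, b, c}"]; auto simp: psi_nth)+
  qed
  ultimately show ?thesis
    using assms unfolding projections_def by blast
qed

lemma projections_idem:
  assumes "\<pi> \<in> projections"
  shows "trace (\<pi> ** \<pi>) = 1"
proof -
  obtain v where v: "\<pi> = rank_one_proj v"
    using projections_rank_one [OF assms] by blast
  then have "cinner v v = 1"
    using trace_projections [OF assms] by (simp add: trace_rank_one_proj)
  then have "\<pi> ** \<pi> = \<pi>"
    using rank_one_proj_mult_rank_one_proj [of v "mat 1"] by (simp add: v mat_scale_def vec_eq_iff)
  then show ?thesis
    using trace_projections [OF assms] by simp
qed

section \<open>Separation by the one- and two-index projections\<close>

lemma trace_mult_pair:
  fixes G H :: "('n::finite) cmat"
  assumes "a \<noteq> b" and H: "\<And>i j. i \<notin> {a, b} \<or> j \<notin> {a, b} \<Longrightarrow> H $ i $ j = 0"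
  shows "trace (G ** H) =
    G $ a $ a * H $ a $ a + G $ a $ b * H $ b $ a + G $ b $ a * H $ a $ b + G $ b $ b * H $ b $ b"
proof -
  have "trace (G ** H) = (\<Sum>i\<in>{a, b}. \<Sum>j\<in>UNIV. G $ i $ j * H $ j $ i)"
    unfolding trace_mult using H by (intro sum.mono_neutral_right) auto
  also have "\<dots> = (\<Sum>i\<in>{a, b}. \<Sum>j\<in>{a, b}. G $ i $ j * H $ j $ i)"
    using H by (intro sum.cong refl sum.mono_neutral_right) auto
  finally show ?thesis
    using assms(1) by simp
qed

lemma psi2_support:
  assumes "i \<notin> {a, b} \<or> j \<notin> {a, b}"
  shows "rank_one_proj (psi_x2 a b) $ i $ j = 0" "rank_one_proj (psi_y2 a b) $ i $ j = 0"
  using assms by (auto simp: psi_nth)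

text \<open>For the difference \<open>Z\<close> of the two matrices, the basis projections read off
  the diagonal, and for each pair the x- and y-projections give the sum and the difference of the
  two off-diagonal entries. Hermiticity is not assumed, so both entries are unknown.\<close>

lemma pair_projections_separate:
  fixes X Y :: "('n::{finite, linorder}) cmat"
  assumes "\<And>\<pi>. \<pi> \<in> pair_projections \<Longrightarrow> trace (\<pi> ** X) = trace (\<pi> ** Y)"
  shows "X = Y"
proof -
  define Z where "Z = X - Y"
  have Z: "trace (Z ** \<pi>) = 0" if "\<pi> \<in> pair_projections" for \<pi>
    using assms [OF that] by (simp add: Z_def trace_mul_sym [of _ \<pi>] matrix_diff_ldistrib trace_sub)
  have diag: "Z $ a $ a = 0" for a
  proof -
    have "trace (Z ** rank_one_proj (ket a)) = 0"
      by (intro Z in_pair_projections)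
    then show ?thesis
      by (simp add: rank_one_proj_ket trace_mult_mat_unit)
  qed
  have off: "Z $ a $ b = 0 \<and> Z $ b $ a = 0" if "a < b" for a b
  proof -
    have neq: "a \<noteq> b" "b \<noteq> a"
      using that by auto
    have tr: "Z $ a $ b * H $ b $ a + Z $ b $ a * H $ a $ b = 0"
      if "H \<in> pair_projections" "\<And>i j. i \<notin> {a, b} \<or> j \<notin> {a, b} \<Longrightarrow> H $ i $ j = 0" for H
      using Z [OF that(1)] trace_mult_pair [OF neq(1) that(2), of Z] by (simp add: diag)
    have x: "Z $ a $ b * rank_one_proj (psi_x2 a b) $ b $ a +
        Z $ b $ a * rank_one_proj (psi_x2 a b) $ a $ b = 0"
      by (intro tr in_pair_projections psi2_support that)
    have y: "Z $ a $ b * rank_one_proj (psi_y2 a b) $ b $ a +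
        Z $ b $ a * rank_one_proj (psi_y2 a b) $ a $ b = 0"
      by (intro tr in_pair_projections psi2_support that)
    have "Z $ a $ b + Z $ b $ a = 0" "\<i> * Z $ a $ b - \<i> * Z $ b $ a = 0"
      using x y neq by (simp_all add: psi_nth field_simps)
    then show ?thesis
      by (simp add: complex_eq_iff)
  qed
  have "Z $ a $ b = 0" for a b
    by (cases a b rule: linorder_cases) (use off diag in auto)
  then show ?thesis
    by (simp add: Z_def vec_eq_iff)
qed

text \<open>Separation is used first on the outputs, then, through the dual maps, on the inputs.
  This replaces an explicit expansion of a matrix in the basis
  \<open>pair_projections\<close>.\<close>

lemma mat_linear_eqI:
  assumes L: "mat_linear L" and L': "mat_linear L'"
    and eq: "\<And>\<pi> \<pi>'. \<pi> \<in> pair_projections \<Longrightarrow> \<pi>' \<in> pair_projections \<Longrightarrow>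
      trace (\<pi> ** L \<pi>') = trace (\<pi> ** L' \<pi>')"
  shows "L = L'"
proof -
  have "L \<pi>' = L' \<pi>'" if "\<pi>' \<in> pair_projections" for \<pi>'
    using eq that by (intro pair_projections_separate) blast
  then have "trace (\<pi> ** dual_map L A) = trace (\<pi> ** dual_map L' A)"
    if "\<pi> \<in> pair_projections" for \<pi> A
    using that by (simp add: trace_mul_sym [of \<pi>] trace_dual_map L L')
  then have "dual_map L A = dual_map L' A" for A
    by (rule pair_projections_separate)
  then have "trace (A ** L B) = trace (A ** L' B)" for A B
    by (metis L L' trace_dual_map)
  then have "L B = L' B" for B
    by (intro pair_projections_separate)
  then show ?thesis
    by blast
qed

lemma hermitian_pair_eqI:
  assumes "hermitian G" "hermitian H"
    and "\<And>i j. i \<notin> {a, b} \<or> j \<notin> {a, b} \<Longrightarrow> G $ i $ j = 0"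
    and "\<And>i j. i \<notin> {a, b} \<or> j \<notin> {a, b} \<Longrightarrow> H $ i $ j = 0"
    and "G $ a $ a = H $ a $ a" "G $ b $ b = H $ b $ b" "G $ a $ b = H $ a $ b"
  shows "G = H"
proof -
  have "G $ b $ a = H $ b $ a"
    using assms hermitian_nth by metis
  then have "G $ i $ j = H $ i $ j" for i j
    using assms(3-) by (cases "i \<in> {a, b} \<and> j \<in> {a, b}") auto
  then show ?thesis
    by (simp add: vec_eq_iff)
qed

text \<open>This is the normalized situation: the images are rank one, and a unitary has already
  rotated the image basis back to the standard one.\<close>

locale projection_image =
  fixes F :: "('n::{finite, linorder}) cmat \<Rightarrow> 'n cmat"
  assumes rank_one: "\<pi> \<in> projections \<Longrightarrow> \<exists>v. F \<pi> = rank_one_proj v"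
    and trace_F: "\<pi> \<in> projections \<Longrightarrow> \<pi>' \<in> projections \<Longrightarrow> trace (F \<pi> ** F \<pi>') = trace (\<pi> ** \<pi>')"
    and ket_F: "F (rank_one_proj (ket a)) = rank_one_proj (ket a)"
begin

lemma F_diag: "\<pi> \<in> projections \<Longrightarrow> F \<pi> $ a $ a = \<pi> $ a $ a"
  using trace_F [of \<pi> "rank_one_proj (ket a)"] ket_F [of a] in_projections(1) [of a]
  by (simp add: rank_one_proj_ket trace_mult_mat_unit)

lemma F_hermitian: "\<pi> \<in> projections \<Longrightarrow> hermitian (F \<pi>)"
  using rank_one hermitian_rank_one_proj by metis

text \<open>In a rank-one matrix the two middle factors combine to a diagonal entry, which
  \<open>F\<close> preserves. The lemma links the phases of three pairs of indices.\<close>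

lemma F_cocycle: "\<pi> \<in> projections \<Longrightarrow> F \<pi> $ a $ b * F \<pi> $ b $ c = F \<pi> $ a $ c * \<pi> $ b $ b"
  using rank_one [of \<pi>] F_diag [of \<pi> b] by (auto simp: rank_one_proj_nth mult_ac)

text \<open>In a rank-one matrix the squared modulus of an entry is a product of two diagonal
  entries.\<close>

lemma cmod_F:
  assumes "\<pi> \<in> projections"
  shows "cmod (F \<pi> $ a $ b) = cmod (\<pi> $ a $ b)"
proof -
  have *: "of_real ((cmod (A $ a $ b))\<^sup>2) = A $ a $ a * A $ b $ b"
    if "A = rank_one_proj v" for A :: "'n cmat" and v
    unfolding complex_norm_square that by (simp add: rank_one_proj_nth mult_ac)
  have "complex_of_real ((cmod (F \<pi> $ a $ b))\<^sup>2) = of_real ((cmod (\<pi> $ a $ b))\<^sup>2)"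
    using rank_one [OF assms] projections_rank_one [OF assms] * F_diag [OF assms] by metis
  then show ?thesis
    by (metis norm_ge_zero of_real_eq_iff power2_eq_iff_nonneg)
qed

lemma F_support:
  assumes "\<pi> \<in> projections" "\<pi> $ a $ b = 0"
  shows "F \<pi> $ a $ b = 0"
  using cmod_F [OF assms(1), of a b] assms(2) by simp

text \<open>As \<open>\<sigma>\<close> lives in one two-by-two block, the overlap consists of
  diagonal terms, which are preserved, and twice the real part in question.\<close>

lemma Re_F:
  assumes \<pi>: "\<pi> \<in> projections" and \<sigma>: "\<sigma> \<in> projections" and "a \<noteq> b"
    and supp: "\<And>i j. i \<notin> {a, b} \<or> j \<notin> {a, b} \<Longrightarrow> \<sigma> $ i $ j = 0"
  shows "Re (F \<pi> $ a $ b * cnj (F \<sigma> $ a $ b)) = Re (\<pi> $ a $ b * cnj (\<sigma> $ a $ b))"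
proof -
  have tr: "Re (trace (G ** H)) = Re (G $ a $ a * H $ a $ a + G $ b $ b * H $ b $ b)
      + 2 * Re (G $ a $ b * cnj (H $ a $ b))"
    if "hermitian G" "hermitian H" "\<And>i j. i \<notin> {a, b} \<or> j \<notin> {a, b} \<Longrightarrow> H $ i $ j = 0"
    for G H :: "'n cmat"
  proof -
    have "G $ b $ a = cnj (G $ a $ b)" "H $ b $ a = cnj (H $ a $ b)"
      using that hermitian_nth by metis+
    moreover have "trace (G ** H) = G $ a $ a * H $ a $ a + G $ a $ b * H $ b $ a
        + G $ b $ a * H $ a $ b + G $ b $ b * H $ b $ b"
      using \<open>a \<noteq> b\<close> that(3) by (rule trace_mult_pair)
    ultimately show ?thesis
      by (simp add: complex_eq_iff)
  qed
  have herm: "hermitian \<pi>" "hermitian \<sigma>"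
    using \<pi> \<sigma> projections_rank_one hermitian_rank_one_proj by metis+
  have "trace (F \<pi> ** F \<sigma>) = trace (\<pi> ** \<sigma>)"
    using \<pi> \<sigma> by (rule trace_F)
  then show ?thesis
    using tr [of \<pi> \<sigma>] tr [of "F \<pi>" "F \<sigma>"] herm F_hermitian \<pi> \<sigma> supp F_support F_diag
    by simp
qed

text \<open>The product has real part \<open>s\<close> by \<open>Re_F\<close> and modulus
  \<open>\<bar>s\<bar>\<close> by \<open>cmod_F\<close>, which leaves no room for an imaginary
  part.\<close>

lemma F_real:
  assumes "\<pi> \<in> projections" "\<sigma> \<in> projections" "a \<noteq> b"
    and "\<And>i j. i \<notin> {a, b} \<or> j \<notin> {a, b} \<Longrightarrow> \<sigma> $ i $ j = 0"
    and s: "\<pi> $ a $ b * cnj (\<sigma> $ a $ b) = of_real s"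
  shows "F \<pi> $ a $ b * cnj (F \<sigma> $ a $ b) = of_real s"
proof -
  define z where "z = F \<pi> $ a $ b * cnj (F \<sigma> $ a $ b)"
  have "Re z = s"
    using Re_F [OF assms(1-4)] s by (simp add: z_def)
  moreover have "cmod z = cmod (\<pi> $ a $ b * cnj (\<sigma> $ a $ b))"
    by (simp add: z_def norm_mult cmod_F assms(1,2))
  then have "(cmod z)\<^sup>2 = s\<^sup>2"
    unfolding s by simp
  ultimately show ?thesis
    unfolding z_def [symmetric] by (simp add: cmod_power2 complex_eq_iff)
qed

text \<open>Overlaps with the two-index projections fix the entries of the images of the three-index ones,
  which have rank one; this makes the phases \<open>z\<close> a multiplicative cocycle, removable by a diagonal
  unitary, and forces the sign in \<open>w = \<plusminus> \<i> z\<close> to be the same for all pairs.\<close>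

definition z where "z a b = 2 * F (rank_one_proj (psi_x2 a b)) $ a $ b"
definition w where "w a b = 2 * F (rank_one_proj (psi_y2 a b)) $ a $ b"

lemma z_unit: "a < b \<Longrightarrow> z a b * cnj (z a b) = 1"
  and w_unit: "a < b \<Longrightarrow> w a b * cnj (w a b) = 1"
  unfolding z_def w_def complex_norm_square [symmetric]
  by (auto simp: norm_mult cmod_F in_projections psi_nth)

lemma F_eq_z:
  assumes "\<pi> \<in> projections" "a < b" "\<pi> $ a $ b = of_real s"
  shows "F \<pi> $ a $ b = of_real s * z a b"
proof -
  have "F \<pi> $ a $ b * cnj (F (rank_one_proj (psi_x2 a b)) $ a $ b) = of_real (s / 2)"
    using assms
    by (intro F_real) (auto simp: in_projections psi2_support psi_nth)
  then have "F \<pi> $ a $ b * cnj (z a b) = of_real s"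
    by (simp add: z_def mult_ac)
  then have "F \<pi> $ a $ b * (z a b * cnj (z a b)) = of_real s * z a b"
    by (simp add: mult_ac)
  then show ?thesis
    using z_unit [OF assms(2)] by simp
qed

text \<open>The comparison is with the y-projection, whose entry is \<open>- \<i> / 2\<close>. The
  factor \<open>- \<i>\<close> in the hypothesis makes the product of the two entries real, as
  \<open>F_real\<close> requires.\<close>

lemma F_eq_w:
  assumes "\<pi> \<in> projections" "a < b" "\<pi> $ a $ b = - \<i> * of_real s"
  shows "F \<pi> $ a $ b = of_real s * w a b"
proof -
  have "F \<pi> $ a $ b * cnj (F (rank_one_proj (psi_y2 a b)) $ a $ b) = of_real (s / 2)"
  proof (rule F_real)
    have "rank_one_proj (psi_y2 a b) $ a $ b = - \<i> / 2"
      using assms(2) by (auto simp: psi_nth)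
    then show "\<pi> $ a $ b * cnj (rank_one_proj (psi_y2 a b) $ a $ b) = of_real (s / 2)"
      using assms(3) by (simp add: complex_eq_iff)
  qed (use assms in \<open>auto simp: in_projections psi2_support\<close>)
  then have "F \<pi> $ a $ b * cnj (w a b) = of_real s"
    by (simp add: w_def mult_ac)
  then have "F \<pi> $ a $ b * (w a b * cnj (w a b)) = of_real s * w a b"
    by (simp add: mult_ac)
  then show ?thesis
    using w_unit [OF assms(2)] by simp
qed

text \<open>All nonzero entries of the projection on \<open>psi_x3 a b c\<close> are
  \<open>1/3\<close>, so each of the three pairs contributes its \<open>z\<close>.\<close>

lemma z_cocycle:
  assumes "a < b" "b < c"
  shows "z a b * z b c = z a c"
proof -
  let ?P = "rank_one_proj (psi_x3 a b c)"
  have P: "?P \<in> projections" and ac: "a < c"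
    using assms by (auto intro: in_projections)
  have "F ?P $ a $ b = of_real (1/3) * z a b" "F ?P $ b $ c = of_real (1/3) * z b c"
    "F ?P $ a $ c = of_real (1/3) * z a c"
    by (rule F_eq_z; use P assms ac in \<open>force simp: psi_nth\<close>)+
  moreover have "?P $ b $ b = 1/3"
    using assms by (auto simp: psi_nth)
  ultimately have "of_real (1/3) * z a b * (of_real (1/3) * z b c) = of_real (1/3) * z a c * (1/3)"
    using F_cocycle [OF P, of a b c] by metis
  then show ?thesis
    by simp
qed

text \<open>In \<open>psi_y3 a b c\<close> only the component at \<open>a\<close> is real. The
  entries pairing \<open>a\<close> with \<open>b\<close> or \<open>c\<close> are thus imaginary and
  the one pairing \<open>b\<close> with \<open>c\<close> is real.\<close>

lemma w_z_cocycle: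
  assumes "a < b" "b < c"
  shows "w a b * z b c = w a c"
proof -
  let ?P = "rank_one_proj (psi_y3 a b c)"
  have P: "?P \<in> projections" and ac: "a < c"
    using assms by (auto intro: in_projections)
  have "F ?P $ a $ b = of_real (1/3) * w a b" "F ?P $ a $ c = of_real (1/3) * w a c"
    by (rule F_eq_w; use P assms ac in \<open>force simp: psi_nth\<close>)+
  moreover have "F ?P $ b $ c = of_real (1/3) * z b c"
    by (rule F_eq_z; use P assms ac in \<open>force simp: psi_nth\<close>)
  moreover have "?P $ b $ b = 1/3"
    using assms by (auto simp: psi_nth)
  ultimately have "of_real (1/3) * w a b * (of_real (1/3) * z b c) = of_real (1/3) * w a c * (1/3)"
    using F_cocycle [OF P, of a b c] by metis
  then show ?thesis
    by simp
qed

text \<open>In \<open>psi_y3 c b a\<close> the real component is at \<open>c\<close>, the last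
  index. Above the diagonal the imaginary entries are now \<open>\<i> / 3\<close>, whence the factor
  \<open>-1/3\<close>.\<close>

lemma z_w_cocycle:
  assumes "a < b" "b < c"
  shows "z a b * w b c = w a c"
proof -
  let ?P = "rank_one_proj (psi_y3 c b a)"
  have P: "?P \<in> projections" and ac: "a < c"
    using assms by (auto intro: in_projections)
  have "F ?P $ b $ c = of_real (-1/3) * w b c" "F ?P $ a $ c = of_real (-1/3) * w a c"
    by (rule F_eq_w; use P assms ac in \<open>force simp: psi_nth\<close>)+
  moreover have "F ?P $ a $ b = of_real (1/3) * z a b"
    by (rule F_eq_z; use P assms ac in \<open>force simp: psi_nth\<close>)
  moreover have "?P $ b $ b = 1/3"
    using assms by (auto simp: psi_nth)
  ultimately have "of_real (1/3) * z a b * (of_real (-1/3) * w b c) = of_real (-1/3) * w a c * (1/3)"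
    using F_cocycle [OF P, of a b c] by metis
  then show ?thesis
    by simp
qed

text \<open>The x- and y-entries of a pair differ by a quarter turn, so
  \<open>w a b * cnj (z a b)\<close> has real part \<open>0\<close>; it also has modulus
  \<open>1\<close>.\<close>

lemma w_cases:
  assumes "a < b"
  shows "w a b = - \<i> * z a b \<or> w a b = \<i> * z a b"
proof -
  define q where "q = w a b * cnj (z a b)"
  have "Re (F (rank_one_proj (psi_y2 a b)) $ a $ b * cnj (F (rank_one_proj (psi_x2 a b)) $ a $ b)) = 0"
    using assms
    by (subst Re_F) (auto simp: in_projections psi2_support psi_nth)
  then have "Re q = 0"
    by (simp add: q_def w_def z_def)
  moreover have "q * cnj q = (w a b * cnj (w a b)) * (z a b * cnj (z a b))"
    by (simp add: q_def mult_ac)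
  then have "q * cnj q = 1"
    by (simp add: z_unit w_unit assms)
  ultimately have "(Im q)\<^sup>2 = 1"
    by (simp add: complex_eq_iff power2_eq_square)
  then have "q = - \<i> \<or> q = \<i>"
    using \<open>Re q = 0\<close> by (auto simp: complex_eq_iff power2_eq_1_iff)
  moreover have "w a b = q * z a b"
    using z_unit [OF assms] by (simp add: q_def mult_ac)
  ultimately show ?thesis
    by auto
qed

lemma w_orientation: "\<exists>t. \<forall>a b. a < b \<longrightarrow> w a b = (if t then \<i> else - \<i>) * z a b"
proof -
  \<comment> \<open>\<open>e\<close> records the sign of a pair. The mixed cocycles show that in a
    triple the outer pair has the sign of each of the two adjacent pairs.\<close>
  define e where "e a b \<longleftrightarrow> w a b = \<i> * z a b" for a b
  have w_e: "w a b = (if e a b then \<i> else - \<i>) * z a b" if "a < b" for a b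
    using w_cases [OF that] by (auto simp: e_def)
  have e_iff: "e a b \<longleftrightarrow> s = \<i>" if "a < b" "w a b = s * z a b" for a b s
    using z_unit [OF that(1)] that(2) by (auto simp: e_def)
  have 1: "e a c \<longleftrightarrow> e a b" if "a < b" "b < c" for a b c
  proof -
    have "w a c = (if e a b then \<i> else - \<i>) * z a c"
      using w_z_cocycle [OF that] z_cocycle [OF that] w_e [OF that(1)] by (metis mult.assoc)
    then show ?thesis
      using e_iff [of a c] that by (auto simp: complex_eq_iff split: if_splits)
  qed
  have 2: "e a c \<longleftrightarrow> e b c" if "a < b" "b < c" for a b c
  proof -
    have "w a c = (if e b c then \<i> else - \<i>) * z a c"
      using z_w_cocycle [OF that] z_cocycle [OF that] w_e [OF that(2)] by (metis mult.left_commute)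
    then show ?thesis
      using e_iff [of a c] that by (auto simp: complex_eq_iff split: if_splits)
  qed
  \<comment> \<open>All pairs are linked through the least index: \<open>(a, b)\<close> has the sign
    of \<open>(m, b)\<close>, and all pairs starting at \<open>m\<close> agree.\<close>
  define m where "m = (Min UNIV :: 'n)"
  have m: "m < a" if "a \<noteq> m" for a
    using that by (simp add: m_def order_less_le)
  have "e a b \<longleftrightarrow> e m b" if "a < b" for a b
    using 2 m that by metis
  moreover have "e m b \<longleftrightarrow> e m c" if "m < b" "m < c" for b c
    using 1 that by (metis linorder_neqE)
  ultimately have "e a b \<longleftrightarrow> e c d" if "a < b" "c < d" for a b c d
    using that m by (metis order_less_trans)
  then show ?thesis
    using w_e by metis
qed

text \<open>Taking the least index as base point, with phase \<open>1\<close> there, the cocycle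
  relation for \<open>m < a < b\<close> expresses every phase through the phases
  \<open>z m a\<close>.\<close>

lemma z_coboundary:
  "\<exists>d. (\<forall>a. d a * cnj (d a) = 1) \<and> (\<forall>a b. a < b \<longrightarrow> z a b = d a * cnj (d b))"
proof -
  define m where "m = (Min UNIV :: 'n)"
  have m: "m < a" if "a \<noteq> m" for a
    using that by (simp add: m_def order_less_le)
  define d where "d a = (if a = m then 1 else cnj (z m a))" for a
  have "d a * cnj (d a) = 1" for a
    using z_unit m by (simp add: d_def mult.commute)
  moreover have "z a b = d a * cnj (d b)" if "a < b" for a b
  proof (cases "a = m")
    case False
    then have "cnj (z m a) * (z m a * z a b) = cnj (z m a) * z m b"
      using z_cocycle m that by simp
    then have "(z m a * cnj (z m a)) * z a b = cnj (z m a) * z m b"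
      by (simp add: mult_ac)
    moreover have "b \<noteq> m"
      using m [OF False] that by auto
    ultimately show ?thesis
      using z_unit [OF m [OF False]] False by (simp add: d_def)
  qed (use that in \<open>auto simp: d_def\<close>)
  ultimately show ?thesis
    by blast
qed

lemma F_eq_symmetry:
  "\<exists>t u. unitary_mat u \<and> (\<forall>\<pi>\<in>pair_projections. F \<pi> = symmetry t u \<pi>)"
proof -
  obtain t where t: "\<And>a b. a < b \<Longrightarrow> w a b = (if t then \<i> else - \<i>) * z a b"
    using w_orientation by blast
  obtain d where d: "\<And>a. d a * cnj (d a) = 1" and z_d: "\<And>a b. a < b \<Longrightarrow> z a b = d a * cnj (d b)"
    using z_coboundary by blast
  \<comment> \<open>Conjugation by this diagonal unitary multiplies the entry at
    \<open>(i, j)\<close> by \<open>d i * cnj (d j)\<close>. Transposition keeps the x-entries and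
    flips the sign of the y-entries, matching \<open>t\<close>.\<close>
  define u where "u = (\<chi> i j. if i = j then d i else 0)"
  have "unitary_mat u"
    using d by (simp add: unitary_mat_def vec_eq_iff u_def matrix_matrix_mult_def mat_def
        if_distrib [of cnj] if_distrib [of "\<lambda>x. x * _"] mult.commute [of "cnj _"] cong: if_cong)
  have sym: "symmetry t u X $ i $ j = d i * cnj (d j) * (if t then X $ j $ i else X $ i $ j)" for X i j
    by (simp add: symmetry_def u_def matrix_matrix_mult_def transpose_def if_distrib [of cnj]
        if_distrib [of "\<lambda>x. x * _"] if_distrib [of "\<lambda>x. _ * x"] mult_ac cong: if_cong)
  have herm: "hermitian (symmetry t u (rank_one_proj v))" for v
    by (simp add: hermitian_def vec_eq_iff sym rank_one_proj_nth mult_ac)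
  have "F (rank_one_proj (ket a)) = symmetry t u (rank_one_proj (ket a))" for a
    using d by (simp add: ket_F) (auto simp: vec_eq_iff sym rank_one_proj_ket mat_unit_def)
  moreover have "F (rank_one_proj (psi_x2 a b)) = symmetry t u (rank_one_proj (psi_x2 a b))"
    if "a < b" for a b
  proof (rule hermitian_pair_eqI [of _ _ a b])
    have P: "rank_one_proj (psi_x2 a b) \<in> projections"
      using that by (rule in_projections)
    then show "hermitian (F (rank_one_proj (psi_x2 a b)))"
      by (rule F_hermitian)
    have "rank_one_proj (psi_x2 a b) $ a $ b = of_real (1/2)" "rank_one_proj (psi_x2 a b) $ b $ a = of_real (1/2)"
      using that by (auto simp: psi_nth)
    moreover from this have "F (rank_one_proj (psi_x2 a b)) $ a $ b = of_real (1/2) * z a b"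
      using F_eq_z [OF P that] by blast
    ultimately show "F (rank_one_proj (psi_x2 a b)) $ a $ b = symmetry t u (rank_one_proj (psi_x2 a b)) $ a $ b"
      unfolding sym by (simp only:) (simp add: z_d that)
  qed (use that d in \<open>auto simp: herm F_support F_diag in_projections psi2_support sym\<close>)
  moreover have "F (rank_one_proj (psi_y2 a b)) = symmetry t u (rank_one_proj (psi_y2 a b))"
    if "a < b" for a b
  proof (rule hermitian_pair_eqI [of _ _ a b])
    have P: "rank_one_proj (psi_y2 a b) \<in> projections"
      using that by (rule in_projections)
    then show "hermitian (F (rank_one_proj (psi_y2 a b)))"
      by (rule F_hermitian)
    have "rank_one_proj (psi_y2 a b) $ a $ b = - \<i> * of_real (1/2)" "rank_one_proj (psi_y2 a b) $ b $ a = \<i> * of_real (1/2)"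
      using that by (auto simp: psi_nth)
    moreover from this have "F (rank_one_proj (psi_y2 a b)) $ a $ b = of_real (1/2) * w a b"
      using F_eq_w [OF P that] by blast
    ultimately show "F (rank_one_proj (psi_y2 a b)) $ a $ b = symmetry t u (rank_one_proj (psi_y2 a b)) $ a $ b"
      unfolding sym by (simp only:) (simp add: z_d t that)
  qed (use that d in \<open>auto simp: herm F_support F_diag in_projections psi2_support sym\<close>)
  ultimately have "\<forall>\<pi>\<in>pair_projections. F \<pi> = symmetry t u \<pi>"
    unfolding pair_projections_def by blast
  with \<open>unitary_mat u\<close> show ?thesis
    by blast
qed

end

section \<open>Uniqueness\<close>

lemma symmetry_rank_one_proj: "symmetry False u (rank_one_proj v) = rank_one_proj (u *v v)"
  unfolding symmetry_def if_False mult_rank_one_proj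
  by (simp add: vec_eq_iff matrix_matrix_mult_def matrix_vector_mult_def rank_one_proj_nth
      sum_distrib_left mult_ac)

lemma symmetry_symmetry_False: "symmetry False u (symmetry t w X) = symmetry t (u ** w) X"
  by (simp add: symmetry_def mat_adjoint_mult matrix_mul_assoc)

lemma orthonormal_unitary_mat:
  assumes "\<And>a b. cinner (v a) (v b) = (if a = b then 1 else 0)"
  shows "unitary_mat (\<chi> i j. v j $ i)"
proof -
  define u where "u = (\<chi> i j. v j $ i)"
  have "mat_adjoint u ** u = mat 1"
    using assms by (simp add: vec_eq_iff matrix_matrix_mult_def mat_def u_def cinner_def)
  then show ?thesis
    using matrix_left_right_inverse [of u "mat_adjoint u"]
    by (simp add: unitary_mat_def u_def [symmetric])
qed

text \<open>In an equivalent representation the state and the effect in the places of one projection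
  could differ a priori, and the effect need not have trace \<open>1\<close>. So \<open>e\<close>
  and \<open>r\<close> are separate, and only mixed overlaps are given.\<close>

lemma projections_rigid:
  fixes e r :: "('n::{finite, linorder}) cmat \<Rightarrow> 'n cmat"
  assumes e: "\<And>\<pi>. \<pi> \<in> projections \<Longrightarrow> pos_semidef (e \<pi>) \<and> pos_semidef (mat 1 - e \<pi>)"
    and r: "\<And>\<pi>. \<pi> \<in> projections \<Longrightarrow> pos_semidef (r \<pi>) \<and> trace (r \<pi>) = 1"
    and tr: "\<And>\<pi> \<pi>'. \<pi> \<in> projections \<Longrightarrow> \<pi>' \<in> projections \<Longrightarrow> trace (e \<pi> ** r \<pi>') = trace (\<pi> ** \<pi>')"
  shows "\<exists>t u. unitary_mat u \<and> (\<forall>\<pi>\<in>pair_projections. e \<pi> = symmetry t u \<pi> \<and> r \<pi> = symmetry t u \<pi>)"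
proof -
  define K where "K a = rank_one_proj (ket a)" for a :: 'n
  have K: "K a \<in> projections" for a
    by (simp add: K_def in_projections)
  have K_nth: "K a $ i $ j = (if i = a then if j = a then 1 else 0 else 0)" for a i j
    by (simp add: K_def rank_one_proj_ket mat_unit_def)
  have tr_K: "trace (X ** K a) = X $ a $ a" for X :: "'n cmat" and a
    by (simp add: K_def rank_one_proj_ket trace_mult_mat_unit)
  have er: "e \<pi> ** r \<pi> = r \<pi>" if "\<pi> \<in> projections" for \<pi>
    using e [OF that] r [OF that] tr [OF that that] projections_idem [OF that]
    by (simp add: effect_mult_state)
  have er_0: "e (K a) ** r (K b) = 0" if "a \<noteq> b" for a b
  proof -
    have "trace (e (K a) ** r (K b)) = 0"
      unfolding tr [OF K K] tr_K using that by (simp add: K_def rank_one_proj_ket mat_unit_def)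
    then show ?thesis
      using e [OF K, of a] r [OF K, of b] by (simp add: pos_semidef_mult_eq_0)
  qed
  \<comment> \<open>The vector \<open>v a\<close> is fixed by \<open>e (K a)\<close> and killed by
    the other \<open>e (K b)\<close>. Eigenvectors of a Hermitian matrix for the eigenvalues
    \<open>1\<close> and \<open>0\<close> are orthogonal.\<close>
  have "\<exists>v. cinner v v = 1 \<and> (\<forall>E. (E ** r (K a) = r (K a) \<longrightarrow> E *v v = v) \<and>
      (E ** r (K a) = 0 \<longrightarrow> E *v v = 0))" for a
    using r [OF K, of a] by (simp add: state_eigenvector pos_semidef_hermitian)
  then obtain v where v: "cinner (v a) (v a) = 1 \<and>
      (\<forall>E. (E ** r (K a) = r (K a) \<longrightarrow> E *v v a = v a) \<and> (E ** r (K a) = 0 \<longrightarrow> E *v v a = 0))" for a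
    using choice [where Q = "\<lambda>a v. cinner v v = 1 \<and>
      (\<forall>E. (E ** r (K a) = r (K a) \<longrightarrow> E *v v = v) \<and> (E ** r (K a) = 0 \<longrightarrow> E *v v = 0))"]
    by blast
  have ev: "e (K a) *v v b = (if a = b then v b else 0)" for a b
    using v [of b] er [OF K, of a] er_0 [of a b] by auto
  have "cinner (v a) (v b) = 0" if "a \<noteq> b" for a b
  proof -
    have "cinner (v a) (v b) = cinner (e (K a) *v v a) (v b)"
      by (simp add: ev)
    also have "\<dots> = cinner (v a) (e (K a) *v v b)"
      using e [OF K] by (simp add: cinner_mult_left pos_semidef_def hermitian_def)
    finally show ?thesis
      using that by (simp add: ev cinner_def)
  qed
  then have orth: "cinner (v a) (v b) = (if a = b then 1 else 0)" for a b
    by (simp add: v)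
  define u where "u = (\<chi> i j. v j $ i)"
  have u: "unitary_mat u"
    unfolding u_def by (rule orthonormal_unitary_mat) (rule orth)
  define q where "q = symmetry_inv False u"
  have q: "unitary_mat q"
    unfolding q_def by (rule unitary_mat_symmetry_inv [OF u])
  \<comment> \<open>\<open>e (K a)\<close> acts on the columns of \<open>u\<close> as
    \<open>K a\<close> acts on the standard basis, so \<open>u\<close> intertwines the two.\<close>
  have "(e (K a) ** u) $ i $ j = (u ** K a) $ i $ j" for a i j
  proof -
    have "(e (K a) ** u) $ i $ j = (e (K a) *v v j) $ i"
      by (simp add: matrix_matrix_mult_def matrix_vector_mult_def u_def)
    also have "\<dots> = (u ** K a) $ i $ j"
      by (simp add: ev matrix_matrix_mult_def u_def K_nth if_distrib [of "\<lambda>x. _ * x"] cong: if_cong)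
    finally show ?thesis .
  qed
  then have "e (K a) ** u = u ** K a" for a
    by (simp add: vec_eq_iff)
  then have "symmetry False u (K a) = e (K a) ** (u ** mat_adjoint u)" for a
    by (simp add: symmetry_def matrix_mul_assoc)
  then have eK: "e (K a) = symmetry False u (K a)" for a
    using u by (simp add: unitary_mat_def)
  then have "trace (e (K a)) = 1" for a
    by (simp add: trace_symmetry u trace_projections K)
  then have rK: "r (K a) = e (K a)" for a
    using e [OF K] r [OF K] er [OF K] by (metis pure_state)
  \<comment> \<open>The matrices \<open>r (K a)\<close> project onto an orthonormal basis, so the
    trace is the sum of the overlaps with them. These are the overlaps of \<open>\<pi>\<close> with
    the \<open>K a\<close>, with sum \<open>trace \<pi>\<close>.\<close>
  have "trace (e \<pi>) = 1" if "\<pi> \<in> projections" for \<pi>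
  proof -
    have "trace (e \<pi>) = (\<Sum>a\<in>UNIV. trace (symmetry False q (e \<pi>) ** K a))"
      unfolding tr_K by (simp add: trace_symmetry q flip: trace_def)
    also have "\<dots> = (\<Sum>a\<in>UNIV. trace (e \<pi> ** r (K a)))"
    proof (rule sum.cong [OF refl])
      fix a
      have "trace (symmetry False q (e \<pi>) ** K a) =
          trace (symmetry False u (symmetry False q (e \<pi>)) ** symmetry False u (K a))"
        by (simp add: trace_symmetry_mult u)
      then show "trace (symmetry False q (e \<pi>) ** K a) = trace (e \<pi> ** r (K a))"
        by (simp add: q_def symmetry_symmetry_inv u rK eK)
    qed
    also have "\<dots> = trace \<pi>"
      unfolding tr [OF that K] tr_K by (simp add: trace_def)
    finally show ?thesis
      using that by (simp add: trace_projections)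
  qed
  then have pure: "\<exists>v. e \<pi> = rank_one_proj v \<and> r \<pi> = e \<pi>" if "\<pi> \<in> projections" for \<pi>
    using e r er that by (metis pure_state)
  \<comment> \<open>Rotating back by the inverse of \<open>u\<close> fixes the basis projections.
    Since \<open>r\<close> and \<open>e\<close> agree on \<open>projections\<close>, the mixed
    overlaps become overlaps of \<open>F\<close> with itself.\<close>
  define F where "F \<pi> = symmetry False q (e \<pi>)" for \<pi>
  interpret projection_image F
  proof
    show "\<exists>v. F \<pi> = rank_one_proj v" if "\<pi> \<in> projections" for \<pi>
      using pure [OF that] by (auto simp: F_def symmetry_rank_one_proj)
    show "trace (F \<pi> ** F \<pi>') = trace (\<pi> ** \<pi>')" if "\<pi> \<in> projections" "\<pi>' \<in> projections" for \<pi> \<pi>'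
      using tr [OF that] pure [OF that(2)] by (auto simp: F_def trace_symmetry_mult q)
    show "F (rank_one_proj (ket a)) = rank_one_proj (ket a)" for a
      unfolding K_def [symmetric] by (simp add: F_def eK q_def symmetry_inv_symmetry u)
  qed
  obtain t s where s: "unitary_mat s" and F: "\<And>\<pi>. \<pi> \<in> pair_projections \<Longrightarrow> F \<pi> = symmetry t s \<pi>"
    using F_eq_symmetry by blast
  have "e \<pi> = symmetry t (u ** s) \<pi>" if "\<pi> \<in> pair_projections" for \<pi>
  proof -
    have "e \<pi> = symmetry False u (F \<pi>)"
      by (simp add: F_def q_def symmetry_symmetry_inv u)
    then show ?thesis
      by (simp add: F that symmetry_symmetry_False)
  qed
  moreover have "r \<pi> = e \<pi>" if "\<pi> \<in> pair_projections" for \<pi>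
    using pure pair_projections_subset that by blast
  ultimately show ?thesis
    using unitary_mat_mult [OF u s] by metis
qed

lemma eq_map_optionI:
  assumes "dom f = dom g" "\<And>x y. g i = Some x \<Longrightarrow> f i = Some y \<Longrightarrow> y = h x"
  shows "f i = map_option h (g i)"
  using assms by (cases "g i"; cases "f i") auto

theorem theorem2:
  fixes m :: "('i, 'j, 'k, 'n::{finite, linorder}) representation"
  assumes "physical m"
    and "projections \<subseteq> ran (states m)"
    and "projections \<subseteq> ran (measurements m)"
  shows "unique_model m"
proof -
  have "m' \<in> model_of m" if "m' \<in> equivalent_physical m" for m'
  proof -
    have m': "physical m'" and same: "same_prob_dist m' m"
      using that by (auto simp: equivalent_physical_def)
    have dom: "dom (states m') = dom (states m)" "dom (maps m') = dom (maps m)"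
        "dom (measurements m') = dom (measurements m)"
      and prob: "\<And>i js k. i \<in> dom (states m) \<Longrightarrow> js \<in> lists (dom (maps m)) \<Longrightarrow>
        k \<in> dom (measurements m) \<Longrightarrow> prob_dist m' i js k = prob_dist m i js k"
      using same by (auto simp: same_prob_dist_def)
    have prob_Nil: "trace (E' ** \<rho>') = trace (E ** \<rho>)"
      if "states m i = Some \<rho>" "states m' i = Some \<rho>'"
        "measurements m k = Some E" "measurements m' k = Some E'" for i k \<rho> \<rho>' E E'
      using prob [of i "[]" k] that by (simp add: prob_dist_def domI)
    have prob_Cons: "trace (E' ** M' \<rho>') = trace (E ** M \<rho>)"
      if "states m i = Some \<rho>" "states m' i = Some \<rho>'" "maps m j = Some M" "maps m' j = Some M'"
        "measurements m k = Some E" "measurements m' k = Some E'" for i j k \<rho> \<rho>' M M' E E'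
      using prob [of i "[j]" k] that by (simp add: prob_dist_def domI)
    \<comment> \<open>For each projection an index is chosen where \<open>m\<close> has it;
      \<open>r\<close> and \<open>e\<close> return what \<open>m'\<close> has there.\<close>
    have "\<exists>i \<rho>'. states m i = Some \<pi> \<and> states m' i = Some \<rho>'" if "\<pi> \<in> projections" for \<pi>
      using assms(2) that dom(1) by (fastforce simp: ran_def)
    then obtain i r where r: "\<And>\<pi>. \<pi> \<in> projections \<Longrightarrow> states m (i \<pi>) = Some \<pi> \<and> states m' (i \<pi>) = Some (r \<pi>)"
      by metis
    have "\<exists>k E'. measurements m k = Some \<pi> \<and> measurements m' k = Some E'" if "\<pi> \<in> projections" for \<pi>
      using assms(3) that dom(3) by (fastforce simp: ran_def)
    then obtain k e where e: "\<And>\<pi>. \<pi> \<in> projections \<Longrightarrow>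
        measurements m (k \<pi>) = Some \<pi> \<and> measurements m' (k \<pi>) = Some (e \<pi>)"
      by metis
    have "\<exists>t u. unitary_mat u \<and> (\<forall>\<pi>\<in>pair_projections. e \<pi> = symmetry t u \<pi> \<and> r \<pi> = symmetry t u \<pi>)"
    proof (rule projections_rigid)
      show "pos_semidef (e \<pi>) \<and> pos_semidef (mat 1 - e \<pi>)" if "\<pi> \<in> projections" for \<pi>
        using m' e [OF that] ranI by (fastforce simp: physical_def)
      show "pos_semidef (r \<pi>) \<and> trace (r \<pi>) = 1" if "\<pi> \<in> projections" for \<pi>
        using m' r [OF that] ranI by (fastforce simp: physical_def)
      show "trace (e \<pi> ** r \<pi>') = trace (\<pi> ** \<pi>')" if "\<pi> \<in> projections" "\<pi>' \<in> projections" for \<pi> \<pi>'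
        using e [OF that(1)] r [OF that(2)] prob_Nil by blast
    qed
    then obtain t u where u: "unitary_mat u"
      and V: "\<And>\<pi>. \<pi> \<in> pair_projections \<Longrightarrow> e \<pi> = symmetry t u \<pi> \<and> r \<pi> = symmetry t u \<pi>"
      by blast
    \<comment> \<open>\<open>transform\<close> applies the inverse symmetry to states, so the
      symmetry carrying \<open>m\<close> to \<open>m'\<close> is the inverse of
      \<open>symmetry t u\<close>.\<close>
    define w where "w = symmetry_inv t u"
    have w: "unitary_mat w"
      unfolding w_def by (rule unitary_mat_symmetry_inv [OF u])
    have ww: "symmetry_inv t w = u"
      by (simp add: w_def)
    have uw: "symmetry t u (symmetry t w X) = X" for X
      by (simp add: w_def symmetry_symmetry_inv u)
    have move: "trace (A ** symmetry t w B) = trace (symmetry t u A ** B)" for A B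
      using trace_symmetry_mult [OF u, of t A "symmetry t w B"] by (simp add: uw)
    note pp = subsetD [OF pair_projections_subset]
    \<comment> \<open>The effects \<open>e \<pi>\<close> test \<open>\<rho>'\<close> as the
      projections \<open>\<pi>\<close> test \<open>\<rho>\<close>. Moving the symmetry across the
      trace leaves a comparison that \<open>pair_projections_separate\<close> decides.\<close>
    have states: "\<rho>' = symmetry t u \<rho>" if \<rho>: "states m i = Some \<rho>" "states m' i = Some \<rho>'" for i \<rho> \<rho>'
    proof -
      have "trace (\<pi> ** symmetry t w \<rho>') = trace (\<pi> ** \<rho>)" if "\<pi> \<in> pair_projections" for \<pi>
        unfolding move using prob_Nil [OF \<rho>] e [OF pp [OF that]] V [OF that] by metis
      then have "symmetry t w \<rho>' = \<rho>"
        by (rule pair_projections_separate)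
      then show ?thesis
        using uw by metis
    qed
    have measurements: "E' = symmetry t u E"
      if E: "measurements m k = Some E" "measurements m' k = Some E'" for k E E'
    proof -
      have "trace (\<pi> ** symmetry t w E') = trace (\<pi> ** E)" if "\<pi> \<in> pair_projections" for \<pi>
        unfolding move trace_mul_sym [of _ E'] trace_mul_sym [of _ E]
        using prob_Nil [OF _ _ E] r [OF pp [OF that]] V [OF that] by metis
      then have "symmetry t w E' = E"
        by (rule pair_projections_separate)
      then show ?thesis
        using uw by metis
    qed
    have maps: "M' = symmetry t u \<circ> M \<circ> symmetry t w"
      if M: "maps m j = Some M" "maps m' j = Some M'" for j M M'
    proof -
      have "completely_positive M" "completely_positive M'"
        using assms(1) m' ranI [of "maps m", OF M(1)] ranI [of "maps m'", OF M(2)]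
        by (simp_all add: physical_def)
      then have lin: "mat_linear M" "mat_linear M'"
        by (simp_all add: completely_positive_def)
      \<comment> \<open>One-letter words, with \<open>r\<close> as inputs and \<open>e\<close> as
        tests, give all matrix elements of the pulled-back map between projections; linearity comes
        from complete positivity.\<close>
      have "symmetry t w \<circ> M' \<circ> symmetry t u = M"
      proof (rule mat_linear_eqI)
        show "mat_linear (symmetry t w \<circ> M' \<circ> symmetry t u)"
          using lin mat_linear_symmetry [of t u] mat_linear_symmetry [of t w] by (simp add: mat_linear_iff)
        show "trace (\<pi> ** (symmetry t w \<circ> M' \<circ> symmetry t u) \<pi>') = trace (\<pi> ** M \<pi>')"
          if "\<pi> \<in> pair_projections" "\<pi>' \<in> pair_projections" for \<pi> \<pi>'
          unfolding comp_def move
          using prob_Cons [OF _ _ M] r [OF pp [OF that(2)]] e [OF pp [OF that(1)]] V that by metis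
      qed (rule lin)
      then have eq: "symmetry t w (M' (symmetry t u X)) = M X" for X
        by (simp add: fun_eq_iff)
      show ?thesis
      proof
        fix X
        have "M' X = symmetry t u (symmetry t w (M' (symmetry t u (symmetry t w X))))"
          by (simp add: uw)
        then show "M' X = (symmetry t u \<circ> M \<circ> symmetry t w) X"
          by (simp add: eq)
      qed
    qed
    have "m' = transform (symmetry t w) m"
    proof (rule representation.equality)
      have "states m' i = map_option (symmetry t u) (states m i)" for i
        using dom(1) states by (rule eq_map_optionI)
      then show "states m' = states (transform (symmetry t w) m)"
        by (simp add: transform_symmetry [OF w] fun_eq_iff ww)
      have "maps m' j = map_option (\<lambda>M. symmetry t u \<circ> M \<circ> symmetry t w) (maps m j)" for j
        using dom(2) maps by (rule eq_map_optionI)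
      then show "maps m' = maps (transform (symmetry t w) m)"
        by (simp add: transform_symmetry [OF w] fun_eq_iff ww)
      have "measurements m' k = map_option (symmetry t u) (measurements m k)" for k
        using dom(3) measurements by (rule eq_map_optionI)
      then show "measurements m' = measurements (transform (symmetry t w) m)"
        by (simp add: transform_symmetry [OF w] fun_eq_iff ww)
    qed simp
    then show ?thesis
      using w by (auto simp: model_of_def symmetry_maps_eq)
  qed
  \<comment> \<open>Conversely, symmetries preserve physicality and all probabilities.\<close>
  moreover have "m' \<in> equivalent_physical m" if "m' \<in> model_of m" for m'
    using that physical_transform_symmetry [OF _ assms(1)] same_prob_dist_transform_symmetry
    by (auto simp: model_of_def symmetry_maps_eq equivalent_physical_def)
  ultimately show ?thesis
    using assms(1) by (auto simp: unique_model_def)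
qed

end
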